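(* Let $(u_n)$ be any positive sequence tending to $0$. Consider the full (two-sided) shift $T$ on two symbols, with a fully supported invariant ergodic probability measure $\mu$. Then there exists a continuous $SL(2,\mathbb R)$-valued cocycle $M$ with a positive top Lyapunov exponent $\lambda_+(M)$ such that, for infinitely many values of $n$, $$\mu\{x:\ \log\|M^n(x)\|\leq n\lambda_+(M)/2\}\geq u_n.$$
   Context: $M:\{0,1\}^{\mathbb Z}\to SL(2,\mathbb R)$ is continuous, $T$ is the left shift, $M^n(x)=M(T^{n-1}x)\dotsm M(x)$, and $\lambda_+(M)$ is the $\mu$-almost sure limit of $\frac1n\log\|M^n(x)\|$. *)

theory Defs
  imports "HOL-Probability.Probability"
begin

text \<open>
  The space \<open>{0,1}\<^sup>\<int>\<close> is the type \<^typ>\<open>int \<Rightarrow> bool\<close>: its topology is the product of the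
  discrete topologies, and \<^term>\<open>borel\<close> is the corresponding Borel sigma-algebra.
\<close>

definition left_shift :: "(int \<Rightarrow> 'a) \<Rightarrow> int \<Rightarrow> 'a" where
  "left_shift x = (\<lambda>i. x (i + 1))"

definition invariant_prob :: "'a::topological_space measure \<Rightarrow> ('a \<Rightarrow> 'a) \<Rightarrow> bool" where
  "invariant_prob \<mu> T \<longleftrightarrow>
     prob_space \<mu> \<and> sets \<mu> = sets borel \<and> T \<in> measurable \<mu> \<mu> \<and> distr \<mu> \<mu> T = \<mu>"

definition ergodic_prob :: "'a::topological_space measure \<Rightarrow> ('a \<Rightarrow> 'a) \<Rightarrow> bool" where
  "ergodic_prob \<mu> T \<longleftrightarrow> invariant_prob \<mu> T \<and>
     (\<forall>A\<in>sets \<mu>. T -` A \<inter> space \<mu> = A \<longrightarrow> measure \<mu> A = 0 \<or> measure \<mu> A = 1)"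

definition fully_supported :: "'a::topological_space measure \<Rightarrow> bool" where
  "fully_supported \<mu> \<longleftrightarrow> (\<forall>U. open U \<and> U \<noteq> {} \<longrightarrow> 0 < emeasure \<mu> U)"

definition continuous_SL2_cocycle :: "('a::topological_space \<Rightarrow> real^2^2) \<Rightarrow> bool" where
  "continuous_SL2_cocycle M \<longleftrightarrow> continuous_on UNIV M \<and> (\<forall>x. det (M x) = 1)"

primrec cocycle_iter :: "('a \<Rightarrow> 'a) \<Rightarrow> ('a \<Rightarrow> real^2^2) \<Rightarrow> nat \<Rightarrow> 'a \<Rightarrow> real^2^2" where
  "cocycle_iter T M 0 x = mat 1"
| "cocycle_iter T M (Suc n) x = M ((T ^^ n) x) ** cocycle_iter T M n x"

text \<open>
  The operator norm for the Euclidean norm on the plane; \<^term>\<open>norm A\<close> would be the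
  Frobenius norm.
\<close>

definition matrix_opnorm :: "real^2^2 \<Rightarrow> real" where
  "matrix_opnorm A = onorm ((*v) A)"

text \<open>
  A relation rather than a function, so that no value is assigned when the almost sure limit
  fails to exist; the limit is unique because \<^term>\<open>\<mu>\<close> is a probability measure.
\<close>

definition has_top_lyapunov_exponent ::
  "'a measure \<Rightarrow> ('a \<Rightarrow> 'a) \<Rightarrow> ('a \<Rightarrow> real^2^2) \<Rightarrow> real \<Rightarrow> bool" where
  "has_top_lyapunov_exponent \<mu> T M l \<longleftrightarrow>
     (AE x in \<mu>. (\<lambda>n. ln (matrix_opnorm (cocycle_iter T M n x)) / real n) \<longlonglongrightarrow> l)"

end

(*
The cocycle is diag(e, 1/e) where x_0 = 1 and a rotation by a small angle where x_0 = 0. The angles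
are the increments (pi/2) (Phi(Tx) - Phi(x)) of a measurable function Phi = sum_j phi_j; Phi is
integer and does not change when x_0 = 1. In the frame rotated by (pi/2) Phi the cocycle is diagonal,
because a quarter turn exchanges the two diagonal entries, so almost surely log |M^n| = |S_n f|,
where f = x_0 cos(pi Phi), and Birkhoff's theorem gives the exponent |int f|, which is positive if
the supports of the phi_j have small total measure.

Each phi_j is 1 on a tower of height n over a clopen base B and ramps up to and down from 1 during
long blocks of zeros at both ends of the tower, so its increments are small. Over a window of length
n centred at the entry time into the tower, f changes sign in the middle, so S_n f is nearly 0. The
measure of the union of the towers can be bounded from below independently of n; hence n can be
chosen so late that u_n is smaller than the measure of these windows. The functions phi_i with i > j
are supported on sets so small that they do not affect the deviation at time n.

The base is found by choosing greedily, among the points whose blocks at times 0 and n consist of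
zeros, a set without returns before a multiple of n; recurrence and ergodicity make these points a
fixed proportion of the space for infinitely many n.
*)
theory Submission
  imports Defs
begin

section \<open>Birkhoff's ergodic theorem\<close>

definition birkhoff_sum :: "('a \<Rightarrow> 'a) \<Rightarrow> ('a \<Rightarrow> real) \<Rightarrow> nat \<Rightarrow> 'a \<Rightarrow> real" where
  "birkhoff_sum T f n x = (\<Sum>i<n. f ((T ^^ i) x))"

lemma birkhoff_sum_Suc: "birkhoff_sum T f (Suc n) x = f x + birkhoff_sum T f n (T x)"
  unfolding birkhoff_sum_def by (subst sum.lessThan_Suc_shift) (simp add: funpow_swap1)

section \<open>Measure and integral under an ergodic transformation\<close>

locale ergodic_system =
  fixes \<mu> :: "'a::topological_space measure" and T :: "'a \<Rightarrow> 'a"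
  assumes ergodic: "ergodic_prob \<mu> T"
begin

lemma sets_eq: "sets \<mu> = sets borel"
  and T_measurable [measurable]: "T \<in> measurable \<mu> \<mu>"
  and distr_T: "distr \<mu> \<mu> T = \<mu>"
  using ergodic by (auto simp: ergodic_prob_def invariant_prob_def)

lemma space_eq [simp]: "space \<mu> = UNIV"
  using sets_eq_imp_space_eq[OF sets_eq] by simp

sublocale prob_space \<mu>
  using ergodic by (simp add: ergodic_prob_def invariant_prob_def)

lemma prob_UNIV [simp]: "measure \<mu> UNIV = 1"
  using prob_space by simp

lemma funpow_measurable [measurable]: "(T ^^ n) \<in> measurable \<mu> \<mu>"
  by (induction n) auto

lemma measure_invariant_0_1:
  assumes "A \<in> sets \<mu>" "\<And>x. T x \<in> A \<longleftrightarrow> x \<in> A"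
  shows "measure \<mu> A = 0 \<or> measure \<mu> A = 1"
proof -
  have "T -` A \<inter> space \<mu> = A"
    using assms(2) by auto
  then show ?thesis
    using ergodic assms(1) unfolding ergodic_prob_def by blast
qed

lemma integrable_comp_T: "integrable \<mu> f \<Longrightarrow> integrable \<mu> (\<lambda>x. f (T x))" for f :: "'a \<Rightarrow> real"
  using integrable_distr[OF T_measurable, of f] by (simp add: distr_T)

lemma integral_comp_T:
  fixes f :: "'a \<Rightarrow> real"
  assumes "integrable \<mu> f"
  shows "(\<integral>x. f (T x) \<partial>\<mu>) = (\<integral>x. f x \<partial>\<mu>)"
  using integral_distr[OF T_measurable, of f] assms by (simp add: distr_T)

lemma measure_vimage_T:
  assumes "A \<in> sets \<mu>"
  shows "measure \<mu> (T -` A) = measure \<mu> A"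
  using measure_distr[OF T_measurable assms] by (simp add: distr_T)

lemma measure_vimage_funpow:
  assumes "A \<in> sets \<mu>"
  shows "measure \<mu> ((T ^^ n) -` A) = measure \<mu> A"
proof (induction n)
  case (Suc n)
  have "(T ^^ n) -` A \<in> sets \<mu>"
    using measurable_sets[OF funpow_measurable assms, of n] by simp
  then have "measure \<mu> (T -` ((T ^^ n) -` A)) = measure \<mu> ((T ^^ n) -` A)"
    by (rule measure_vimage_T)
  then show ?case
    using Suc by (simp add: vimage_comp funpow_swap1 o_def)
qed auto

lemma birkhoff_sum_measurable [measurable]:
  "f \<in> borel_measurable \<mu> \<Longrightarrow> birkhoff_sum T f n \<in> borel_measurable \<mu>"
  unfolding birkhoff_sum_def
  by (intro borel_measurable_sum measurable_compose[OF funpow_measurable])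

text \<open>\<open>partial_max f n x\<close> is the maximum of the Birkhoff sums of length at most \<open>n\<close>.\<close>

primrec partial_max :: "('a \<Rightarrow> real) \<Rightarrow> nat \<Rightarrow> 'a \<Rightarrow> real" where
  "partial_max f 0 x = 0"
| "partial_max f (Suc n) x = max 0 (f x + partial_max f n (T x))"

lemma partial_max_nonneg: "0 \<le> partial_max f n x"
  by (cases n) auto

lemma partial_max_Suc_ge: "partial_max f n x \<le> partial_max f (Suc n) x"
proof (induction n arbitrary: x)
  case (Suc n)
  from Suc[of "T x"] show ?case by auto
qed simp

lemma birkhoff_sum_le_partial_max: "birkhoff_sum T f n x \<le> partial_max f n x"
proof (induction n arbitrary: x)
  case 0
  then show ?case by (simp add: birkhoff_sum_def)
next
  case (Suc n)
  from Suc[of "T x"] show ?case by (auto simp: birkhoff_sum_Suc)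
qed

lemma partial_max_integrable:
  assumes "integrable \<mu> f"
  shows "integrable \<mu> (partial_max f n)"
proof (induction n)
  case (Suc n)
  from integrable_comp_T[OF this] assms
  have "integrable \<mu> (\<lambda>x. max 0 (f x + partial_max f n (T x)))"
    by (intro integrable_max Bochner_Integration.integrable_add) auto
  moreover have "partial_max f (Suc n) = (\<lambda>x. max 0 (f x + partial_max f n (T x)))"
    by (rule ext) simp
  ultimately show ?case by simp
qed simp

text \<open>Garsia's argument: where \<open>partial_max f n\<close> is positive, its decrease from
  \<open>x\<close> to \<open>T x\<close> is at most \<open>f x\<close>, and elsewhere the decrease
  is at most 0. The integral of the decrease vanishes by invariance.\<close>

lemma maximal_ergodic_inequality:
  assumes f: "integrable \<mu> f"
  shows "0 \<le> (\<integral>x. indicator {x. 0 < partial_max f n x} x * f x \<partial>\<mu>)"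
proof (cases n)
  case 0
  then show ?thesis by simp
next
  case (Suc k)
  have int: "integrable \<mu> (partial_max f n)"
    using partial_max_integrable[OF f] .
  have [measurable]: "partial_max f n \<in> borel_measurable \<mu>" "f \<in> borel_measurable \<mu>"
    using int f by auto
  have "0 = (\<integral>x. partial_max f n x - partial_max f n (T x) \<partial>\<mu>)"
    using int integrable_comp_T[OF int] integral_comp_T[OF int] by simp
  also have "\<dots> \<le> (\<integral>x. indicator {x. 0 < partial_max f n x} x * f x \<partial>\<mu>)"
  proof (rule integral_mono)
    have "{x \<in> space \<mu>. 0 < partial_max f n x} \<in> sets \<mu>"
      by measurable
    then show "integrable \<mu> (\<lambda>x. indicator {x. 0 < partial_max f n x} x * f x)"
      using integrable_mult_indicator[OF _ f, of "{x. 0 < partial_max f n x}"] by auto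
    show "partial_max f n x - partial_max f n (T x)
        \<le> indicator {x. 0 < partial_max f n x} x * f x" for x
      using partial_max_nonneg[of f n "T x"] partial_max_nonneg[of f n x]
        partial_max_Suc_ge[of f k "T x"] Suc
      by (auto simp: indicator_def max_def not_less split: if_splits)
  qed (use int integrable_comp_T[OF int] in auto)
  finally show ?thesis .
qed

text \<open>The sets in the maximal inequality increase with \<open>n\<close> and exhaust almost all
  of the space, so dominated convergence carries the inequality to the limit.\<close>

lemma integral_nonneg_if_birkhoff_sum_pos:
  assumes f: "integrable \<mu> f" and pos: "AE x in \<mu>. \<exists>n. 0 < birkhoff_sum T f n x"
  shows "0 \<le> (\<integral>x. f x \<partial>\<mu>)"
proof (rule LIMSEQ_le_const)
  have [measurable]: "partial_max f n \<in> borel_measurable \<mu>" "f \<in> borel_measurable \<mu>" for n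
    using partial_max_integrable[OF f] f by auto
  show "(\<lambda>n. \<integral>x. indicator {x. 0 < partial_max f n x} x * f x \<partial>\<mu>) \<longlonglongrightarrow> (\<integral>x. f x \<partial>\<mu>)"
  proof (rule integral_dominated_convergence)
    show "integrable \<mu> (\<lambda>x. norm (f x))"
      using f by simp
    show "AE x in \<mu>. (\<lambda>n. indicator {x. 0 < partial_max f n x} x * f x) \<longlonglongrightarrow> f x"
      using pos
    proof eventually_elim
      case (elim x)
      then obtain n where n: "0 < birkhoff_sum T f n x" by blast
      have "indicator {x. 0 < partial_max f m x} x * f x = f x" if "n \<le> m" for m
      proof -
        have "partial_max f n x \<le> partial_max f m x"
          using that partial_max_Suc_ge by (rule lift_Suc_mono_le[rotated])
        then show ?thesis
          using n birkhoff_sum_le_partial_max[of f n x] by simp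
      qed
      then show ?case
        by (intro tendsto_eventually eventually_sequentiallyI)
    qed
  qed (auto simp: indicator_def)
  show "\<exists>N. \<forall>n\<ge>N. 0 \<le> (\<integral>x. indicator {x. 0 < partial_max f n x} x * f x \<partial>\<mu>)"
    using maximal_ergodic_inequality[OF f] by blast
qed

text \<open>Passing from \<open>x\<close> to \<open>T x\<close> changes the sums by
  \<open>f x\<close> and a shift of the index, so unboundedness from above is an invariant property.
  By ergodicity it holds almost everywhere or almost nowhere, and the former would force a
  nonnegative integral.\<close>

lemma birkhoff_sum_bounded_above:
  assumes f: "integrable \<mu> f" and neg: "(\<integral>x. f x \<partial>\<mu>) < 0"
  shows "AE x in \<mu>. \<exists>C. \<forall>n. birkhoff_sum T f n x \<le> C"
proof -
  have [measurable]: "f \<in> borel_measurable \<mu>"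
    using f by auto
  \<comment> \<open>Natural bounds \<open>C\<close> make \<open>A\<close> a countable combination of
    measurable sets.\<close>
  define A where "A = {x. \<forall>C::nat. \<exists>n. real C < birkhoff_sum T f n x}"
  have A_iff: "x \<in> A \<longleftrightarrow> \<not> (\<exists>C. \<forall>n. birkhoff_sum T f n x \<le> C)" for x
  proof -
    have "(\<exists>C::nat. \<forall>n. birkhoff_sum T f n x \<le> real C)" if "\<forall>n. birkhoff_sum T f n x \<le> C" for C
      using that real_arch_simple[of C] by (meson order_trans)
    then show ?thesis unfolding A_def by (force simp: not_le[symmetric])
  qed
  have "{x \<in> space \<mu>. \<forall>C::nat. \<exists>n. real C < birkhoff_sum T f n x} \<in> sets \<mu>"
    by measurable
  then have meas: "A \<in> sets \<mu>"
    by (simp add: A_def)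
  have inv: "T x \<in> A \<longleftrightarrow> x \<in> A" for x
  proof -
    have "(\<exists>C. \<forall>n. birkhoff_sum T f n (T x) \<le> C) \<longleftrightarrow> (\<exists>C. \<forall>n. birkhoff_sum T f n x \<le> C)"
    proof safe
      fix C assume C: "\<forall>n. birkhoff_sum T f n (T x) \<le> C"
      have "birkhoff_sum T f n x \<le> max 0 (f x + C)" for n
        using C by (cases n) (auto simp: birkhoff_sum_Suc birkhoff_sum_def[of _ _ 0] le_max_iff_disj)
      then show "\<exists>C. \<forall>n. birkhoff_sum T f n x \<le> C" by blast
    next
      fix C assume C: "\<forall>n. birkhoff_sum T f n x \<le> C"
      have "birkhoff_sum T f n (T x) \<le> C - f x" for n
        using C[rule_format, of "Suc n"] by (simp add: birkhoff_sum_Suc)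
      then show "\<exists>C. \<forall>n. birkhoff_sum T f n (T x) \<le> C" by blast
    qed
    then show ?thesis by (simp add: A_iff)
  qed
  have "measure \<mu> A \<noteq> 1"
  proof
    assume "measure \<mu> A = 1"
    then have "AE x in \<mu>. x \<in> A"
      using meas by (simp add: AE_in_set_eq_1)
    then have "AE x in \<mu>. \<exists>n. 0 < birkhoff_sum T f n x"
      by eventually_elim (simp add: A_def, metis of_nat_0)
    with integral_nonneg_if_birkhoff_sum_pos[OF f] neg show False by simp
  qed
  then have "measure \<mu> A = 0"
    using measure_invariant_0_1[OF meas inv] by blast
  then have "AE x in \<mu>. x \<notin> A"
    using meas by (simp add: AE_iff_measurable[OF _ refl] emeasure_eq_measure)
  then show ?thesis
    by (simp add: A_iff)
qed

text \<open>Subtracting slightly more than the mean makes the integral negative, hence the sums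
  bounded above by a constant, which is negligible after division by \<open>n\<close>. The margins
  \<open>1 / Suc k\<close> keep the exceptional null sets countable in number.\<close>

lemma birkhoff_sum_eventually_le:
  assumes f: "integrable \<mu> f"
  shows "AE x in \<mu>. \<forall>e>0. \<forall>\<^sub>F n in sequentially. birkhoff_sum T f n x / n \<le> (\<integral>x. f x \<partial>\<mu>) + e"
proof -
  define I where "I = (\<integral>x. f x \<partial>\<mu>)"
  have "AE x in \<mu>. \<exists>C. \<forall>n. birkhoff_sum T f n x \<le> n * (I + 1 / Suc k) + C" for k
  proof -
    define g where "g x = f x - (I + 1 / Suc k)" for x
    have "integrable \<mu> g" "(\<integral>x. g x \<partial>\<mu>) < 0"
      using f by (simp_all add: g_def[abs_def] I_def)
    then have "AE x in \<mu>. \<exists>C. \<forall>n. birkhoff_sum T g n x \<le> C"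
      by (rule birkhoff_sum_bounded_above)
    moreover have "birkhoff_sum T g n x = birkhoff_sum T f n x - n * (I + 1 / Suc k)" for n x
      by (simp add: birkhoff_sum_def g_def sum_subtractf)
    ultimately show ?thesis
      by (simp add: algebra_simps)
  qed
  then have "AE x in \<mu>. \<forall>k. \<exists>C. \<forall>n. birkhoff_sum T f n x \<le> n * (I + 1 / Suc k) + C"
    by (subst AE_all_countable) blast
  then show ?thesis
    unfolding I_def[symmetric]
  proof (eventually_elim, intro allI impI)
    fix x and e :: real
    assume *: "\<forall>k. \<exists>C. \<forall>n. birkhoff_sum T f n x \<le> n * (I + 1 / Suc k) + C" and "0 < e"
    obtain k :: nat where k: "1 / Suc k < e / 2"
      using nat_approx_posE[of "e / 2"] \<open>0 < e\<close> by auto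
    obtain C where C: "\<And>n. birkhoff_sum T f n x \<le> n * (I + 1 / Suc k) + C"
      using * by blast
    obtain N :: nat where N: "\<bar>C\<bar> \<le> N * (e / 2)"
      using real_arch_simple[of "\<bar>C\<bar> / (e / 2)"] \<open>0 < e\<close> by (auto simp: field_simps)
    show "\<forall>\<^sub>F n in sequentially. birkhoff_sum T f n x / n \<le> I + e"
    proof (rule eventually_sequentiallyI[of "Suc N"])
      fix n assume n: "Suc N \<le> n"
      have "birkhoff_sum T f n x \<le> n * (I + 1 / Suc k) + C" by (rule C)
      also have "\<dots> \<le> n * (I + e / 2) + n * (e / 2)"
      proof (intro add_mono mult_left_mono)
        have "C \<le> N * (e / 2)" using N by linarith
        also have "\<dots> \<le> n * (e / 2)" using n \<open>0 < e\<close> by (intro mult_right_mono) auto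
        finally show "C \<le> n * (e / 2)" .
      qed (use k in auto)
      also have "\<dots> = n * (I + e)" by (simp add: algebra_simps)
      finally show "birkhoff_sum T f n x / n \<le> I + e"
        using n by (simp add: divide_le_eq mult.commute)
    qed
  qed
qed

lemma birkhoff_ergodic_theorem:
  assumes f: "integrable \<mu> f"
  shows "AE x in \<mu>. (\<lambda>n. birkhoff_sum T f n x / n) \<longlonglongrightarrow> (\<integral>x. f x \<partial>\<mu>)"
proof -
  have neg: "birkhoff_sum T (\<lambda>x. - f x) n x = - birkhoff_sum T f n x" for n x
    by (simp add: birkhoff_sum_def sum_negf)
  have "integrable \<mu> (\<lambda>x. - f x)"
    using f by simp
  from birkhoff_sum_eventually_le[OF f] birkhoff_sum_eventually_le[OF this]
  show ?thesis
  proof eventually_elim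
    case (elim x)
    show ?case
    proof (rule tendstoI)
      fix e :: real assume "0 < e"
      then have "0 < e / 2" by simp
      with elim have "\<forall>\<^sub>F n in sequentially. birkhoff_sum T f n x / n \<le> (\<integral>x. f x \<partial>\<mu>) + e / 2"
        "\<forall>\<^sub>F n in sequentially. birkhoff_sum T (\<lambda>x. - f x) n x / n \<le> (\<integral>x. - f x \<partial>\<mu>) + e / 2"
        by blast+
      then show "\<forall>\<^sub>F n in sequentially. dist (birkhoff_sum T f n x / n) (\<integral>x. f x \<partial>\<mu>) < e"
      proof eventually_elim
        case (elim n)
        then show ?case
          using \<open>0 < e\<close> by (simp add: neg dist_real_def abs_less_iff)
      qed
    qed
  qed
qed

text \<open>An Egorov argument: the sets of points with error at most \<open>e * n\<close> from time
  \<open>h\<close> on increase with \<open>h\<close> to a set of full measure.\<close>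

lemma birkhoff_sum_uniform:
  assumes f: "integrable \<mu> f" and "0 < e" "0 < d"
  shows "\<exists>G h. G \<in> sets \<mu> \<and> 1 - d \<le> measure \<mu> G \<and>
           (\<forall>x\<in>G. \<forall>n\<ge>h. \<bar>birkhoff_sum T f n x - n * (\<integral>x. f x \<partial>\<mu>)\<bar> \<le> e * n)"
proof -
  have [measurable]: "f \<in> borel_measurable \<mu>"
    using f by auto
  define I where "I = (\<integral>x. f x \<partial>\<mu>)"
  define G where "G h = {x. \<forall>n\<ge>h. \<bar>birkhoff_sum T f n x - n * I\<bar> \<le> e * n}" for h :: nat
  have "{x \<in> space \<mu>. \<forall>n\<ge>h. \<bar>birkhoff_sum T f n x - n * I\<bar> \<le> e * n} \<in> sets \<mu>" for h
    by measurable
  then have G: "G h \<in> sets \<mu>" for h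
    by (simp add: G_def)
  have "AE x in \<mu>. x \<in> (\<Union>h. G h)"
    using birkhoff_ergodic_theorem[OF f]
  proof eventually_elim
    case (elim x)
    then have "\<forall>\<^sub>F n in sequentially. dist (birkhoff_sum T f n x / n) I < e"
      using \<open>0 < e\<close> unfolding I_def by (rule tendstoD)
    then obtain h where h: "\<And>n. h \<le> n \<Longrightarrow> \<bar>birkhoff_sum T f n x / n - I\<bar> < e"
      by (auto simp: eventually_sequentially dist_real_def)
    \<comment> \<open>\<open>Suc h\<close> excludes \<open>n = 0\<close>, so that the division by
      \<open>n\<close> can be undone.\<close>
    have "\<bar>birkhoff_sum T f n x - n * I\<bar> \<le> e * n" if "Suc h \<le> n" for n
    proof -
      have "birkhoff_sum T f n x - n * I = n * (birkhoff_sum T f n x / n - I)"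
        using that by (simp add: right_diff_distrib)
      then have "\<bar>birkhoff_sum T f n x - n * I\<bar> = n * \<bar>birkhoff_sum T f n x / n - I\<bar>"
        by (simp add: abs_mult)
      also have "\<dots> \<le> n * e"
        using h[of n] that by (intro mult_left_mono) auto
      finally show ?thesis by (simp add: mult.commute)
    qed
    then show ?case by (auto simp: G_def)
  qed
  then have "measure \<mu> (\<Union>h. G h) = 1"
    using G by (subst (asm) AE_in_set_eq_1) auto
  moreover have "(\<lambda>h. measure \<mu> (G h)) \<longlonglongrightarrow> measure \<mu> (\<Union>h. G h)"
  proof (rule finite_Lim_measure_incseq)
    show "incseq G"
      by (auto simp: incseq_def G_def)
  qed (use G in auto)
  ultimately have "\<forall>\<^sub>F h in sequentially. dist (measure \<mu> (G h)) 1 < d"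
    using \<open>0 < d\<close> by (auto intro: tendstoD)
  then obtain h where "dist (measure \<mu> (G h)) 1 < d"
    by (auto simp: eventually_sequentially)
  then show ?thesis
    using G[of h] unfolding I_def[symmetric]
    by (intro exI[of _ "G h"] exI[of _ h]) (auto simp: G_def dist_real_def)
qed

text \<open>Integrating Birkhoff's theorem for the indicator of \<open>Z\<close> over
  \<open>Z\<close> shows that the averages of the measures of the return sets tend to the square of
  the measure of \<open>Z\<close>. If all terms from \<open>N\<close> on were below half of that,
  the limit would be at most this half.\<close>

lemma frequent_recurrence:
  assumes Z: "Z \<in> sets \<mu>" and pos: "0 < measure \<mu> Z"
  shows "\<exists>n\<ge>N. (measure \<mu> Z)\<^sup>2 / 2 \<le> measure \<mu> (Z \<inter> (T ^^ n) -` Z)"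
proof (rule ccontr)
  define z where "z = measure \<mu> Z"
  define a where "a n = measure \<mu> (Z \<inter> (T ^^ n) -` Z)" for n
  assume "\<not> ?thesis"
  then have a: "a n < z\<^sup>2 / 2" if "N \<le> n" for n
    using that unfolding a_def z_def by (meson not_le)
  have Zn: "Z \<inter> (T ^^ n) -` Z \<in> sets \<mu>" for n
    using measurable_sets[OF funpow_measurable Z, of n] Z by simp
  define f :: "'a \<Rightarrow> real" where "f = indicator Z"
  have f: "integrable \<mu> f" "(\<integral>x. f x \<partial>\<mu>) = z"
    using Z by (simp_all add: f_def z_def less_top[symmetric])
  have [measurable]: "f \<in> borel_measurable \<mu>"
    using f by auto
  have "(\<lambda>n. \<integral>x. f x * (birkhoff_sum T f n x / n) \<partial>\<mu>) \<longlonglongrightarrow> (\<integral>x. f x * z \<partial>\<mu>)"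
  proof (rule integral_dominated_convergence[where w = "\<lambda>_. 1"])
    show "AE x in \<mu>. (\<lambda>n. f x * (birkhoff_sum T f n x / n)) \<longlonglongrightarrow> f x * z"
      using birkhoff_ergodic_theorem[OF f(1)] unfolding f(2)
      by eventually_elim (intro tendsto_intros)
    have "norm (f x * (birkhoff_sum T f n x / n)) \<le> 1" for n x
    proof -
      have "birkhoff_sum T f n x \<le> (\<Sum>i<n. 1)"
        unfolding birkhoff_sum_def by (intro sum_mono) (auto simp: f_def indicator_def)
      moreover have "0 \<le> birkhoff_sum T f n x"
        unfolding birkhoff_sum_def by (intro sum_nonneg) (auto simp: f_def)
      ultimately show ?thesis
        by (auto simp: f_def indicator_def divide_le_eq_1)
    qed
    then show "AE x in \<mu>. norm (f x * (birkhoff_sum T f n x / n)) \<le> 1" for n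
      by simp
  qed auto
  moreover have "(\<integral>x. f x * (birkhoff_sum T f n x / n) \<partial>\<mu>) = (\<Sum>i<n. a i) / n" for n
  proof -
    have "f x * (birkhoff_sum T f n x / n) = (\<Sum>i<n. indicator (Z \<inter> (T ^^ i) -` Z) x) / n" for x
      by (simp add: birkhoff_sum_def sum_distrib_left f_def indicator_def if_distrib cong: if_cong)
    then have "(\<integral>x. f x * (birkhoff_sum T f n x / n) \<partial>\<mu>) =
        (\<integral>x. (\<Sum>i<n. indicator (Z \<inter> (T ^^ i) -` Z) x) \<partial>\<mu>) / n"
      by (simp only: Bochner_Integration.integral_divide_zero)
    also have "(\<integral>x. (\<Sum>i<n. indicator (Z \<inter> (T ^^ i) -` Z) x) \<partial>\<mu>) = (\<Sum>i<n. a i)"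
      using Zn by (subst Bochner_Integration.integral_sum) (auto simp: a_def less_top[symmetric])
    finally show ?thesis .
  qed
  ultimately have "(\<lambda>n. (\<Sum>i<n. a i) / n) \<longlonglongrightarrow> (\<integral>x. f x * z \<partial>\<mu>)"
    by (simp only:)
  then have lim: "(\<lambda>n. (\<Sum>i<n. a i) / n) \<longlonglongrightarrow> z\<^sup>2"
    using f by (simp add: power2_eq_square)
  have "(\<lambda>n. real N / n + z\<^sup>2 / 2) \<longlonglongrightarrow> 0 + z\<^sup>2 / 2"
    by (intro tendsto_intros lim_const_over_n)
  moreover have "(\<Sum>i<n. a i) / n \<le> real N / n + z\<^sup>2 / 2" if "0 < n" for n
  proof -
    have "(\<Sum>i<n. a i) \<le> (\<Sum>i<n. (if i < N then 1 else 0) + z\<^sup>2 / 2)"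
    proof (rule sum_mono)
      show "a i \<le> (if i < N then 1 else 0) + z\<^sup>2 / 2" for i
        using a[of i] by (auto simp: not_less a_def intro: add_increasing2)
    qed
    also have "\<dots> = card ({..<n} \<inter> {i. i < N}) + n * (z\<^sup>2 / 2)"
      by (simp add: sum.distrib sum.If_cases)
    also have "\<dots> \<le> N + n * (z\<^sup>2 / 2)"
      using card_mono[of "{..<N}" "{..<n} \<inter> {i. i < N}"] by auto
    finally show ?thesis
      using that by (simp add: field_simps)
  qed
  ultimately have "z\<^sup>2 \<le> 0 + z\<^sup>2 / 2"
    by (intro LIMSEQ_le[OF lim]) (auto intro: exI[of _ 1])
  then show False
    using pos by (simp add: z_def)
qed

end

section \<open>Clopen marker sets in the full shift\<close>

text \<open>Integer powers of the shift: towers have to be followed backwards in time as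
  well.\<close>

definition shift_by :: "int \<Rightarrow> (int \<Rightarrow> 'a) \<Rightarrow> int \<Rightarrow> 'a" where
  "shift_by l x = (\<lambda>i. x (i + l))"

lemma shift_by_shift_by [simp]: "shift_by k (shift_by l x) = shift_by (k + l) x"
  by (simp add: shift_by_def add_ac)

lemma shift_by_0 [simp]: "shift_by 0 x = x"
  by (simp add: shift_by_def)

lemma left_shift_eq_shift_by: "left_shift = shift_by 1"
  by (simp add: fun_eq_iff left_shift_def shift_by_def)

lemma funpow_left_shift: "(left_shift ^^ n) x = shift_by (int n) x"
  by (induction n) (simp_all add: left_shift_eq_shift_by)

lemma continuous_shift_by: "continuous_on UNIV (shift_by l :: (int \<Rightarrow> 'a::topological_space) \<Rightarrow> _)"
  unfolding shift_by_def
  by (intro continuous_on_coordinatewise_then_product continuous_on_product_coordinates)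

definition clopen :: "'a::topological_space set \<Rightarrow> bool" where
  "clopen A \<longleftrightarrow> open A \<and> closed A"

lemma clopen_Un: "clopen A \<Longrightarrow> clopen B \<Longrightarrow> clopen (A \<union> B)"
  and clopen_Int: "clopen A \<Longrightarrow> clopen B \<Longrightarrow> clopen (A \<inter> B)"
  and clopen_Diff: "clopen A \<Longrightarrow> clopen B \<Longrightarrow> clopen (A - B)"
  by (auto simp: clopen_def)

lemma clopen_empty: "clopen {}"
  by (auto simp: clopen_def)

lemma clopen_UN: "finite I \<Longrightarrow> (\<And>i. i \<in> I \<Longrightarrow> clopen (A i)) \<Longrightarrow> clopen (\<Union>i\<in>I. A i)"
  by (auto simp: clopen_def)

lemma clopen_Collect_ball:
  assumes "finite I" "\<And>i. i \<in> I \<Longrightarrow> clopen {x. P i x}"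
  shows "clopen {x. \<forall>i\<in>I. P i x}"
proof -
  have "{x. \<forall>i\<in>I. P i x} = (\<Inter>i\<in>I. {x. P i x})" by auto
  then show ?thesis
    using assms by (auto simp: clopen_def)
qed

lemma clopen_vimage: "continuous_on UNIV f \<Longrightarrow> clopen A \<Longrightarrow> clopen (f -` A)"
  by (auto simp: clopen_def open_vimage closed_vimage)

lemma clopen_coordinate: "clopen {x :: int \<Rightarrow> bool. x i}"
proof -
  have "clopen ((\<lambda>x :: int \<Rightarrow> bool. x i) -` {True})"
    by (intro clopen_vimage) (simp_all add: clopen_def discrete_topology_class.open_discrete)
  then show ?thesis by (simp add: vimage_def)
qed

lemma clopen_not_coordinate: "clopen {x :: int \<Rightarrow> bool. \<not> x i}"
proof -
  have "clopen ((\<lambda>x :: int \<Rightarrow> bool. x i) -` {False})"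
    by (intro clopen_vimage) (simp_all add: clopen_def discrete_topology_class.open_discrete)
  then show ?thesis by (simp add: vimage_def)
qed

lemma clopen_coordinate_eq: "clopen {x :: int \<Rightarrow> bool. x i = b}"
  using clopen_coordinate[of i] clopen_not_coordinate[of i] by (cases b) auto

lemma clopen_coordinates_eq: "clopen {x :: int \<Rightarrow> bool. x i = x j}"
proof -
  have "{x :: int \<Rightarrow> bool. x i = x j} = ({x. x i} \<inter> {x. x j}) \<union> ({x. \<not> x i} \<inter> {x. \<not> x j})"
    by auto
  then show ?thesis
    by (simp add: clopen_Un clopen_Int clopen_coordinate clopen_not_coordinate)
qed

lemma continuous_on_indicator_clopen:
  "clopen A \<Longrightarrow> continuous_on UNIV (indicator A :: _ \<Rightarrow> real)"
  using continuous_on_cases[of A "- A" "\<lambda>_. 1 :: real" "\<lambda>_. 0" "\<lambda>x. x \<in> A"]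
  by (auto simp: clopen_def indicator_def of_bool_def)

text \<open>Greedy choice: run through the sets of the family, adding to the set found so far the points
  that lie at a time distance greater than \<open>H\<close> from it.\<close>

lemma greedy_marker_set:
  fixes \<C> :: "(int \<Rightarrow> bool) set set"
  assumes "finite \<C>" and "0 \<le> H" and "\<And>C. C \<in> \<C> \<Longrightarrow> clopen C"
    and "\<And>C x p. C \<in> \<C> \<Longrightarrow> x \<in> C \<Longrightarrow> p \<in> {1..H} \<Longrightarrow> shift_by p x \<notin> C"
  shows "\<exists>B. clopen B \<and> B \<subseteq> \<Union>\<C> \<and> (\<forall>x\<in>B. \<forall>p\<in>{1..H}. shift_by p x \<notin> B) \<and>
           \<Union>\<C> \<subseteq> (\<Union>l\<in>{-H..H}. shift_by l -` B)"
  using assms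
proof (induction \<C> rule: finite_induct)
  case empty
  show ?case by (intro exI[of _ "{}"]) (auto simp: clopen_empty)
next
  case (insert C \<C>)
  then obtain B where B: "clopen B" "B \<subseteq> \<Union>\<C>"
      "\<And>x p. x \<in> B \<Longrightarrow> p \<in> {1..H} \<Longrightarrow> shift_by p x \<notin> B"
      "\<Union>\<C> \<subseteq> (\<Union>l\<in>{-H..H}. shift_by l -` B)"
    by (metis insertCI)
  define N where "N = (\<Union>l\<in>{-H..H}. shift_by l -` B)"
  have "clopen N"
    unfolding N_def using B(1) by (intro clopen_UN clopen_vimage continuous_shift_by) auto
  \<comment> \<open>A new point lies in \<open>C - N\<close>, so it keeps its distance from
    \<open>B\<close> in both time directions: the fact \<open>N\<close> treats an old point met
    later, \<open>N'\<close> an old point met earlier.\<close>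
  have N: "shift_by l x \<notin> B" if "x \<notin> N" "\<bar>l\<bar> \<le> H" for x l
    using that unfolding N_def by force
  have N': "x \<notin> B" if "shift_by l x \<notin> N" "\<bar>l\<bar> \<le> H" for x l
    using N[OF that(1), of "-l"] that(2) by auto
  define B' where "B' = B \<union> (C - N)"
  show ?case
  proof (intro exI[of _ B'] conjI ballI)
    show "clopen B'"
      unfolding B'_def using insert.prems(2) \<open>clopen N\<close> B(1) by (intro clopen_Un clopen_Diff) auto
    show "B' \<subseteq> \<Union>(insert C \<C>)"
      using B(2) by (auto simp: B'_def)
    show "shift_by p x \<notin> B'" if "x \<in> B'" "p \<in> {1..H}" for x p
      using that B(3)[of x p] N[of x p] N'[of p x] insert.prems(3)[of C x p] by (auto simp: B'_def)
    show "\<Union>(insert C \<C>) \<subseteq> (\<Union>l\<in>{-H..H}. shift_by l -` B')"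
    proof
      fix x assume x: "x \<in> \<Union>(insert C \<C>)"
      show "x \<in> (\<Union>l\<in>{-H..H}. shift_by l -` B')"
      proof (cases "x \<in> N")
        case True
        then show ?thesis by (auto simp: N_def B'_def)
      next
        case False
        have "x \<in> C" using x False B(4) by (auto simp: N_def)
        then show ?thesis
          using False \<open>0 \<le> H\<close> by (auto simp: B'_def intro!: bexI[of _ 0])
      qed
    qed
  qed
qed

section \<open>Aperiodicity and marker sets for a fully supported ergodic measure\<close>

locale full_shift_system = ergodic_system \<mu> left_shift for \<mu> :: "(int \<Rightarrow> bool) measure" +
  assumes full_support: "fully_supported \<mu>"
begin

lemma clopen_in_sets: "clopen A \<Longrightarrow> A \<in> sets \<mu>"
  by (auto simp: sets_eq clopen_def)

lemma continuous_measurable: "continuous_on UNIV f \<Longrightarrow> f \<in> borel_measurable \<mu>"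
  unfolding measurable_cong_sets[OF sets_eq refl] by (rule borel_measurable_continuous_onI)

lemma shift_by_in_sets:
  assumes "A \<in> sets \<mu>"
  shows "shift_by l -` A \<in> sets \<mu>"
proof -
  have "shift_by l \<in> measurable borel borel"
    by (intro borel_measurable_continuous_onI continuous_shift_by)
  from measurable_sets[OF this, of A] assms show ?thesis
    by (simp add: sets_eq)
qed

lemma measure_shift_by:
  assumes "A \<in> sets \<mu>"
  shows "measure \<mu> (shift_by l -` A) = measure \<mu> A"
proof -
  have nonneg: "measure \<mu> (shift_by (int n) -` A) = measure \<mu> A" if "A \<in> sets \<mu>" for n A
    using measure_vimage_funpow[OF that, of n] by (simp add: funpow_left_shift[abs_def])
  show ?thesis
  proof (cases "0 \<le> l")
    case True
    then show ?thesis
      using nonneg[OF assms, of "nat l"] by simp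
  next
    case False
    have "measure \<mu> (shift_by (int (nat (- l))) -` (shift_by l -` A)) = measure \<mu> (shift_by l -` A)"
      by (rule nonneg[OF shift_by_in_sets[OF assms]])
    then show ?thesis
      using False by (simp add: vimage_comp o_def)
  qed
qed

lemma measure_clopen_pos: "clopen A \<Longrightarrow> A \<noteq> {} \<Longrightarrow> 0 < measure \<mu> A"
  using full_support unfolding fully_supported_def clopen_def
  by (simp add: emeasure_eq_measure)

lemma clopen_periodic_on_window: "clopen {x :: int \<Rightarrow> bool. \<forall>i\<in>{-m..m}. x i = x (i + p)}"
  by (intro clopen_Collect_ball clopen_coordinates_eq) auto

text \<open>The set is closed and shift-invariant, so ergodicity leaves measure 0 or 1. It misses
  the cylinder \<open>x 0 \<and> \<not> x p\<close>, which has positive measure by full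
  support.\<close>

lemma measure_periodic_points:
  assumes "0 < p"
  shows "measure \<mu> {x. \<forall>i. x i = x (i + p)} = 0"
proof -
  let ?A = "{x :: int \<Rightarrow> bool. \<forall>i. x i = x (i + p)}"
  have eq: "?A = (\<Inter>i. {x. x i = x (i + p)})" by blast
  have "closed ?A"
    unfolding eq using clopen_coordinates_eq by (intro closed_INT) (auto simp: clopen_def)
  then have sets: "?A \<in> sets \<mu>" by (simp add: sets_eq)
  have "left_shift x \<in> ?A \<longleftrightarrow> x \<in> ?A" for x
  proof
    assume *: "left_shift x \<in> ?A"
    show "x \<in> ?A"
    proof (intro CollectI allI)
      show "x i = x (i + p)" for i
        using spec[OF CollectD[OF *], of "i - 1"] by (simp add: left_shift_def algebra_simps)
    qed
  next
    assume *: "x \<in> ?A"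
    show "left_shift x \<in> ?A"
    proof (intro CollectI allI)
      show "left_shift x i = left_shift x (i + p)" for i
        using spec[OF CollectD[OF *], of "i + 1"] by (simp add: left_shift_def algebra_simps)
    qed
  qed
  from measure_invariant_0_1[OF sets this]
  show ?thesis
  proof
    assume 1: "measure \<mu> ?A = 1"
    have "clopen {x :: int \<Rightarrow> bool. x 0 \<and> \<not> x p}"
      using clopen_Int[OF clopen_coordinate[of 0] clopen_not_coordinate[of p]]
      by (simp add: Int_def)
    moreover have "(\<lambda>i. i = 0) \<in> {x :: int \<Rightarrow> bool. x 0 \<and> \<not> x p}"
      using assms by simp
    ultimately have "0 < measure \<mu> {x. x 0 \<and> \<not> x p}" "{x. x 0 \<and> \<not> x p} \<in> sets \<mu>"
      by (blast intro: measure_clopen_pos clopen_in_sets)+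
    moreover have "?A \<inter> {x. x 0 \<and> \<not> x p} = {}"
    proof -
      have "x 0 = x p" if "x \<in> ?A" for x
        using spec[OF CollectD[OF that], of 0] by simp
      then show ?thesis by blast
    qed
    moreover from calculation have "measure \<mu> (?A \<union> {x. x 0 \<and> \<not> x p}) = 
        measure \<mu> ?A + measure \<mu> {x. x 0 \<and> \<not> x p}"
      using sets by (intro finite_measure_Union) auto
    moreover have "measure \<mu> (?A \<union> {x. x 0 \<and> \<not> x p}) \<le> 1"
      by (rule prob_le_1)
    ultimately show ?thesis using 1 by linarith
  qed
qed

text \<open>For fixed \<open>p\<close> the points that look \<open>p\<close>-periodic on a window
  decrease to the truly periodic points as the window grows; only finitely many \<open>p\<close> are
  involved.\<close>

lemma periodic_on_window_small:
  assumes "0 < e"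
  shows "\<exists>m. measure \<mu> (\<Union>p\<in>{1..H}. {x. \<forall>i\<in>{-m..m}. x i = x (i + p)}) < e"
proof -
  define D where "D p m = {x :: int \<Rightarrow> bool. \<forall>i\<in>{-int m..int m}. x i = x (i + p)}" for p and m :: nat
  have D: "D p m \<in> sets \<mu>" for p m
    unfolding D_def by (intro clopen_in_sets clopen_periodic_on_window)
  have "(\<lambda>m. measure \<mu> (D p m)) \<longlonglongrightarrow> 0" if "p \<in> {1..H}" for p
  proof -
    have "(\<lambda>m. measure \<mu> (D p m)) \<longlonglongrightarrow> measure \<mu> (\<Inter>m. D p m)"
    proof (rule finite_Lim_measure_decseq)
      show "decseq (D p)"
        unfolding decseq_def D_def by fastforce
    qed (use D in auto)
    moreover have "(\<Inter>m. D p m) = {x. \<forall>i. x i = x (i + p)}"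
    proof -
      have "i \<in> {-int (nat \<bar>i\<bar>)..int (nat \<bar>i\<bar>)}" for i by auto
      then show ?thesis unfolding D_def by blast
    qed
    ultimately show ?thesis
      using measure_periodic_points[of p] that by simp
  qed
  then have "(\<lambda>m. \<Sum>p\<in>{1..H}. measure \<mu> (D p m)) \<longlonglongrightarrow> 0"
    by (rule tendsto_null_sum)
  then have "\<forall>\<^sub>F m in sequentially. (\<Sum>p\<in>{1..H}. measure \<mu> (D p m)) < e"
    using assms by (rule order_tendstoD(2))
  then obtain m where "(\<Sum>p\<in>{1..H}. measure \<mu> (D p m)) < e"
    by (auto simp: eventually_sequentially)
  moreover have "measure \<mu> (\<Union>p\<in>{1..H}. D p m) \<le> (\<Sum>p\<in>{1..H}. measure \<mu> (D p m))"
    using D by (intro finite_measure_subadditive_finite) auto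
  ultimately show ?thesis
    unfolding D_def by (intro exI[of _ "int m"]) auto
qed

text \<open>Up to the small set \<open>P\<close>, \<open>A\<close> splits into cylinders over a
  window. A point that returned to its own cylinder within time \<open>H\<close> would look periodic
  on the window and lie in \<open>P\<close>, so the greedy choice applies. The
  \<open>2 * H + 1\<close> translates of the resulting set cover \<open>A - P\<close>.\<close>

lemma marker_set:
  assumes A: "clopen A" and "0 \<le> H" and "0 < e"
  shows "\<exists>B. clopen B \<and> B \<subseteq> A \<and> (\<forall>x\<in>B. \<forall>p\<in>{1..H}. shift_by p x \<notin> B) \<and>
           measure \<mu> A \<le> (2 * H + 1) * measure \<mu> B + e"
proof -
  obtain m where m: "measure \<mu> (\<Union>p\<in>{1..H}. {x. \<forall>i\<in>{-m..m}. x i = x (i + p)}) < e"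
    using periodic_on_window_small[OF \<open>0 < e\<close>] by blast
  define W where "W = {-m..m}"
  define P where "P = (\<Union>p\<in>{1..H}. {x :: int \<Rightarrow> bool. \<forall>i\<in>W. x i = x (i + p)})"
  have P: "clopen P"
    unfolding P_def W_def by (intro clopen_UN clopen_periodic_on_window) auto
  define cyl where "cyl w = {x. \<forall>i\<in>W. x i = (i \<in> w)} \<inter> (A - P)" for w
  have "finite (cyl ` Pow W)"
    by (simp add: W_def)
  moreover have "clopen C" if "C \<in> cyl ` Pow W" for C
    using that P A unfolding cyl_def W_def
    by (auto intro!: clopen_Int clopen_Diff clopen_Collect_ball clopen_coordinate_eq)
  moreover have "shift_by p x \<notin> C" if C: "C \<in> cyl ` Pow W" and x: "x \<in> C" and p: "p \<in> {1..H}"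
    for C x p
  proof
    assume "shift_by p x \<in> C"
    with C x have "\<forall>i\<in>W. x i = x (i + p)"
      by (auto simp: cyl_def shift_by_def)
    then have "x \<in> P" using p by (auto simp: P_def)
    then show False using C x by (auto simp: cyl_def)
  qed
  ultimately obtain B where B: "clopen B" "B \<subseteq> \<Union>(cyl ` Pow W)"
      "\<forall>x\<in>B. \<forall>p\<in>{1..H}. shift_by p x \<notin> B"
      "\<Union>(cyl ` Pow W) \<subseteq> (\<Union>l\<in>{-H..H}. shift_by l -` B)"
    using greedy_marker_set[of "cyl ` Pow W" H] \<open>0 \<le> H\<close> by blast
  have Un: "\<Union>(cyl ` Pow W) = A - P"
  proof (intro equalityI subsetI)
    show "x \<in> A - P" if "x \<in> \<Union>(cyl ` Pow W)" for x
      using that by (auto simp: cyl_def)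
    show "x \<in> \<Union>(cyl ` Pow W)" if "x \<in> A - P" for x
    proof (rule UnionI)
      show "x \<in> cyl {i \<in> W. x i}"
        using that by (simp add: cyl_def)
    qed auto
  qed
  have B_sets: "shift_by l -` B \<in> sets \<mu>" for l
    using B(1) by (intro shift_by_in_sets clopen_in_sets)
  have "measure \<mu> A \<le> measure \<mu> ((\<Union>l\<in>{-H..H}. shift_by l -` B) \<union> P)"
    using B(4) P B_sets by (intro finite_measure_mono) (auto simp: Un intro: clopen_in_sets)
  also have "\<dots> \<le> measure \<mu> (\<Union>l\<in>{-H..H}. shift_by l -` B) + measure \<mu> P"
    using B_sets P by (intro measure_Un_le) (auto intro: clopen_in_sets)
  also have "measure \<mu> (\<Union>l\<in>{-H..H}. shift_by l -` B) \<le> (\<Sum>l\<in>{-H..H}. measure \<mu> (shift_by l -` B))"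
    using B_sets by (intro finite_measure_subadditive_finite) auto
  also have "\<dots> = (2 * H + 1) * measure \<mu> B"
    using B(1) \<open>0 \<le> H\<close> by (simp add: measure_shift_by clopen_in_sets)
  also have "measure \<mu> P \<le> e"
    using m by (simp add: P_def W_def)
  finally show ?thesis
    using B Un by (intro exI[of _ B]) auto
qed

end

section \<open>Towers over marker sets\<close>

text \<open>For \<open>0 < L \<le> n\<close> a trapezoid: it climbs from 0 to 1 on
  \<open>[0, L]\<close>, stays at 1 until \<open>n\<close> and is back at 0 from
  \<open>n + L\<close> on.\<close>

definition ramp :: "nat \<Rightarrow> nat \<Rightarrow> int \<Rightarrow> real" where
  "ramp L n l = max 0 (min 1 (min (l / L) ((int n + int L - l) / L)))"

lemma ramp_eq_0: "l \<le> 0 \<or> int n + int L \<le> l \<Longrightarrow> ramp L n l = 0"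
proof -
  assume "l \<le> 0 \<or> int n + int L \<le> l"
  then have "l / L \<le> 0 \<or> (int n + int L - l) / L \<le> 0"
    by (auto simp: divide_le_0_iff)
  then show ?thesis
    unfolding ramp_def by linarith
qed

lemma ramp_eq_1:
  assumes "0 < L" "int L \<le> l" "l \<le> int n"
  shows "ramp L n l = 1"
proof -
  have "real L \<le> l" "real L \<le> real_of_int (int n + int L - l)"
    using assms(2,3) by linarith+
  then have "1 \<le> l / L" "1 \<le> (int n + int L - l) / L"
    using assms(1) by (simp_all only: le_divide_eq_1 of_nat_0_less_iff simp_thms)
  then show ?thesis
    unfolding ramp_def by linarith
qed

lemma ramp_Lipschitz: "\<bar>ramp L n (l + 1) - ramp L n l\<bar> \<le> 1 / L"
proof -
  define a b e where "a = l / L" and "b = (int n + int L - l) / L" and "e = 1 / real L"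
  have "(l + 1) / L = a + e" "(int n + int L - (l + 1)) / L = b - e" "0 \<le> e"
    by (simp_all add: a_def b_def e_def add_divide_distrib diff_divide_distrib)
  then have "ramp L n (l + 1) = max 0 (min 1 (min (a + e) (b - e)))"
    "ramp L n l = max 0 (min 1 (min a b))"
    by (simp_all only: ramp_def a_def b_def)
  moreover have "\<bar>min (a + e) (b - e) - min a b\<bar> \<le> e"
    using \<open>0 \<le> e\<close> by linarith
  ultimately show ?thesis
    unfolding e_def by linarith
qed

text \<open>The index \<open>l\<close> is the time since a visit to \<open>B\<close>. Summing over
  all candidates makes continuity immediate; under the separation assumed below at most one term is
  nonzero.\<close>

definition tower_function :: "(int \<Rightarrow> bool) set \<Rightarrow> nat \<Rightarrow> nat \<Rightarrow> (int \<Rightarrow> bool) \<Rightarrow> real" where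
  "tower_function B L n x = (\<Sum>l\<in>{0..int n + int L}. indicator B (shift_by (- l) x) * ramp L n l)"

lemma tower_function_eq_0:
  "(\<And>l. l \<in> {0..int n + int L} \<Longrightarrow> shift_by (- l) x \<notin> B) \<Longrightarrow> tower_function B L n x = 0"
  by (simp add: tower_function_def)

lemma continuous_tower_function: "clopen B \<Longrightarrow> continuous_on UNIV (tower_function B L n)"
  unfolding tower_function_def[abs_def]
  by (intro continuous_intros continuous_on_compose2[OF continuous_on_indicator_clopen
        continuous_shift_by]) auto

context
  fixes B :: "(int \<Rightarrow> bool) set" and L n :: nat and H :: int
  assumes separated: "\<forall>x\<in>B. \<forall>p\<in>{1..H}. shift_by p x \<notin> B"
    and bounds: "0 < L" "L < n" "3 * int n \<le> H"
begin

lemma separated_unique: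
  assumes "shift_by k x \<in> B" "shift_by l x \<in> B" "\<bar>k - l\<bar> \<le> H"
  shows "k = l"
proof (rule ccontr)
  assume "k \<noteq> l"
  then consider "k < l" | "l < k" by linarith
  then show False
  proof cases
    case 1
    with bspec[OF bspec[OF separated assms(1)], of "l - k"] assms show False by simp
  next
    case 2
    with bspec[OF bspec[OF separated assms(2)], of "k - l"] assms show False by simp
  qed
qed

text \<open>Every index of the sum differs from \<open>l\<close> by less than
  \<open>3 * int n\<close>, so separation leaves no other candidate. A negative \<open>l\<close>, or
  one beyond \<open>n + L\<close>, describes a point outside the tower, where both sides are
  0.\<close>

lemma tower_function_eq_ramp:
  assumes "shift_by (- l) x \<in> B" "- int n \<le> l" "l \<le> 2 * int n"
  shows "tower_function B L n x = ramp L n l"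
proof -
  have "tower_function B L n x = (\<Sum>k\<in>{0..int n + int L}. if k = l then ramp L n l else 0)"
    unfolding tower_function_def
  proof (rule sum.cong)
    fix k assume k: "k \<in> {0..int n + int L}"
    show "indicator B (shift_by (- k) x) * ramp L n k = (if k = l then ramp L n l else 0)"
    proof (cases "k = l")
      case False
      have "\<bar>- k - - l\<bar> \<le> H"
        using k assms bounds by auto
      then have "shift_by (- k) x \<notin> B"
        using separated_unique[OF _ assms(1), of "- k"] False by auto
      then show ?thesis using False by simp
    qed (use assms(1) in simp)
  qed simp
  also have "\<dots> = ramp L n l"
    by (auto simp: ramp_eq_0)
  finally show ?thesis .
qed

lemma tower_function_left_shift:
  obtains l where "shift_by (- l) x \<in> B" "tower_function B L n x = ramp L n l"
    "tower_function B L n (left_shift x) = ramp L n (l + 1)"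
  | "tower_function B L n x = 0" "tower_function B L n (left_shift x) = 0"
\<comment> \<open>The range starts at -1 to cover the step that enters the base: there
  \<open>left_shift x\<close> lies in \<open>B\<close>.\<close>
proof (cases "\<exists>l\<in>{- 1..int n + int L}. shift_by (- l) x \<in> B")
  case True
  then obtain l where l: "- 1 \<le> l" "l \<le> int n + int L" "shift_by (- l) x \<in> B"
    by auto
  moreover from l have "shift_by (- (l + 1)) (left_shift x) \<in> B"
    by (simp add: left_shift_eq_shift_by)
  ultimately show ?thesis
    using bounds by (intro that(1)[of l] tower_function_eq_ramp) auto
next
  case False
  have "shift_by (- l) (left_shift x) \<notin> B" if "l \<in> {0..int n + int L}" for l
  proof -
    have "shift_by (- (l - 1)) x \<notin> B"
    proof
      assume "shift_by (- (l - 1)) x \<in> B"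
      moreover have "l - 1 \<in> {- 1..int n + int L}"
        using that by auto
      ultimately show False
        using False by blast
    qed
    then show ?thesis
      by (simp add: left_shift_eq_shift_by)
  qed
  with False show ?thesis
    by (intro that(2) tower_function_eq_0) auto
qed

end

text \<open>The angle \<open>\<pi>/2 \<cdot> \<phi>\<close> of a frame in which the cocycle is diagonal: it may only move at times when
  the cocycle is a rotation, and it is a multiple of \<open>\<pi>/2\<close> when the cocycle is hyperbolic.\<close>

definition twist :: "((int \<Rightarrow> bool) \<Rightarrow> real) \<Rightarrow> bool" where
  "twist \<phi> \<longleftrightarrow> continuous_on UNIV \<phi> \<and> (\<forall>x. x 0 \<longrightarrow> \<phi> x \<in> \<int> \<and> \<phi> (left_shift x) = \<phi> x)"

text \<open>The exponent of the hyperbolic factor seen in the rotated frame: for integer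
  \<open>\<phi> x\<close> the cosine is the sign that records whether the frame has exchanged the
  axes.\<close>

definition twisted :: "((int \<Rightarrow> bool) \<Rightarrow> real) \<Rightarrow> (int \<Rightarrow> bool) \<Rightarrow> real" where
  "twisted \<phi> x = (if x 0 then cos (pi * \<phi> x) else 0)"

lemma twist_add: "twist \<phi> \<Longrightarrow> twist \<psi> \<Longrightarrow> twist (\<lambda>x. \<phi> x + \<psi> x)"
  by (auto simp: twist_def intro!: continuous_intros)

lemma abs_twisted_le: "\<bar>twisted \<phi> x\<bar> \<le> (if x 0 then 1 else 0)"
  by (simp add: twisted_def)

section \<open>Integrals of twisted functions, and one twist that produces a deviation\<close>

context full_shift_system
begin

lemma twisted_measurable:
  assumes "\<phi> \<in> borel_measurable \<mu>"
  shows "twisted \<phi> \<in> borel_measurable \<mu>"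
proof -
  have "Measurable.pred \<mu> (\<lambda>x. x 0)"
    using clopen_in_sets[OF clopen_coordinate[of 0]] by (simp add: pred_def)
  with assms show ?thesis
    unfolding twisted_def[abs_def] by measurable
qed

lemma twisted_integrable:
  assumes "\<phi> \<in> borel_measurable \<mu>"
  shows "integrable \<mu> (twisted \<phi>)"
  using abs_twisted_le[of \<phi>]
  by (intro integrable_const_bound[of _ 1] twisted_measurable[OF assms]) (auto simp: twisted_def)

lemma abs_integral_twisted_le:
  assumes "\<phi> \<in> borel_measurable \<mu>"
  shows "\<bar>\<integral>x. twisted \<phi> x \<partial>\<mu>\<bar> \<le> measure \<mu> {x. x 0}"
proof -
  have sets: "{x. x 0} \<in> sets \<mu>"
    by (intro clopen_in_sets clopen_coordinate)
  have "\<bar>\<integral>x. twisted \<phi> x \<partial>\<mu>\<bar> \<le> (\<integral>x. \<bar>twisted \<phi> x\<bar> \<partial>\<mu>)"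
    by (rule integral_abs_bound)
  also have "\<dots> \<le> (\<integral>x. indicator {x. x 0} x \<partial>\<mu>)"
  proof (rule integral_mono)
    show "\<bar>twisted \<phi> x\<bar> \<le> indicator {x. x 0} x" for x
      using abs_twisted_le[of \<phi> x] by (cases "x 0") simp_all
  qed (use sets twisted_integrable[OF assms] in \<open>auto simp: less_top[symmetric]\<close>)
  finally show ?thesis using sets by simp
qed

text \<open>The inductive step: adding one more twist to \<open>\<Phi>\<close>, as slow and as
  rarely nonzero as desired, spoils the growth at some late time \<open>n\<close>. The factor 2 in
  \<open>2 * u n\<close> leaves room for the effect of the twists added afterwards.\<close>

lemma twist_with_deviation:
  assumes \<Phi>: "twist \<Phi>" and "0 < \<eta>" and u: "u \<longlonglongrightarrow> (0::real)"
  shows "\<exists>\<phi> n. twist \<phi> \<and> N < n \<and> (\<forall>x. \<bar>\<phi> (left_shift x) - \<phi> x\<bar> \<le> \<eta>) \<and>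
           measure \<mu> {x. \<phi> x \<noteq> 0} \<le> \<eta> \<and>
           2 * u n \<le> measure \<mu>
             {x. \<bar>birkhoff_sum left_shift (twisted (\<lambda>x. \<Phi> x + \<phi> x)) n x\<bar> \<le> n * measure \<mu> {x. x 0} / 4}"
proof -
  define a where "a = measure \<mu> {x. x 0}"
  have "(\<lambda>_. True) \<in> {x :: int \<Rightarrow> bool. x 0}" by simp
  then have a: "0 < a"
    unfolding a_def using measure_clopen_pos[OF clopen_coordinate[of 0]] by blast
  \<comment> \<open>\<open>L\<close> is the ramp length; a slope \<open>1 / L\<close> of at most
    \<open>\<eta>\<close> bounds the increments.\<close>
  obtain L' :: nat where "1 / Suc L' < \<eta>"
    using nat_approx_posE[OF \<open>0 < \<eta>\<close>] by blast
  define L where "L = Suc L'"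
  have L: "0 < L" "1 / L \<le> \<eta>"
    using \<open>1 / Suc L' < \<eta>\<close> by (auto simp: L_def)
  define Z where "Z = {x :: int \<Rightarrow> bool. \<forall>i\<in>{0..<int L}. \<not> x i}"
  have Z: "clopen Z"
    unfolding Z_def by (intro clopen_Collect_ball clopen_not_coordinate) auto
  have "(\<lambda>_. False) \<in> Z" by (simp add: Z_def)
  then have z: "0 < measure \<mu> Z"
    using measure_clopen_pos[OF Z] by blast
  define c where "c = (measure \<mu> Z)\<^sup>2 / 2"
  have c: "0 < c" using z by (simp add: c_def)
  \<comment> \<open>Returns to the base will take longer than \<open>K * n\<close>, while a tower
    takes up at most \<open>2 * n\<close> levels, so the towers have measure at most
    \<open>2 / K\<close>.\<close>
  obtain K' :: nat where K': "2 / \<eta> \<le> K'"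
    using real_arch_simple by blast
  define K where "K = K' + 3"
  have K: "3 \<le> K" "2 / K \<le> \<eta>"
    using K' \<open>0 < \<eta>\<close> by (auto simp: K_def field_simps)
  \<comment> \<open>The base will satisfy \<open>c / (6 * K) \<le> n * measure \<mu> B\<close>, and
    the entry times used below number at least \<open>n / 64\<close>, so the points with these entry
    times have measure at least \<open>2 * d\<close>. At least half of this survives the removal of
    the points outside \<open>G\<close>. The value does not depend on \<open>n\<close>, which is
    chosen afterwards.\<close>
  define d where "d = c / (768 * K)"
  have d: "0 < d" using c K by (simp add: d_def)
  have \<Phi>_meas: "\<Phi> \<in> borel_measurable \<mu>"
    using \<Phi> by (intro continuous_measurable) (simp add: twist_def)
  define f where "f = twisted \<Phi>"
  have f: "integrable \<mu> f" unfolding f_def by (rule twisted_integrable[OF \<Phi>_meas])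
  define I where "I = (\<integral>x. f x \<partial>\<mu>)"
  have I: "\<bar>I\<bar> \<le> a"
    unfolding I_def f_def a_def by (rule abs_integral_twisted_le[OF \<Phi>_meas])
  \<comment> \<open>The Birkhoff errors at times \<open>j\<close> and \<open>n\<close> enter with
    weights 2 and 1, hence cost at most \<open>a * n / 8\<close> in total; the same amount is left
    for \<open>j\<close> not being exactly \<open>n / 2\<close>.\<close>
  have "0 < a / 24" using a by simp
  from birkhoff_sum_uniform[OF f this d] obtain G h where
    G: "G \<in> sets \<mu>" "1 - d \<le> measure \<mu> G" and
    h: "\<And>x n. x \<in> G \<Longrightarrow> h \<le> n \<Longrightarrow> \<bar>birkhoff_sum left_shift f n x - n * I\<bar> \<le> a / 24 * n"
    unfolding I_def by blast
  have "\<forall>\<^sub>F n in sequentially. u n < d / 2"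
    using u d by (intro order_tendstoD(2)[OF u]) auto
  then obtain n0 where n0: "\<And>n. n0 \<le> n \<Longrightarrow> u n < d / 2"
    by (auto simp: eventually_sequentially)
  \<comment> \<open>\<open>4 * h\<close> makes half of \<open>n\<close> late enough for the bounds
    on \<open>G\<close>, and 32 makes \<open>n div 32\<close> positive.\<close>
  obtain n where n: "Max {Suc N, n0, 4 * h, Suc (Suc L), 32} \<le> n"
      and "(measure \<mu> Z)\<^sup>2 / 2 \<le> measure \<mu> (Z \<inter> (left_shift ^^ n) -` Z)"
    using frequent_recurrence[OF clopen_in_sets[OF Z] z] by blast
  then have n: "N < n" "n0 \<le> n" "4 * h \<le> n" "Suc L < n" "32 \<le> n"
    and rec: "c \<le> measure \<mu> (Z \<inter> shift_by n -` Z)"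
    by (auto simp: c_def funpow_left_shift[abs_def])
  define H where "H = int K * int n"
  have H: "3 * int n \<le> H" "0 \<le> H"
    using mult_right_mono[of 3 "int K" "int n"] K(1) by (simp_all add: H_def)
  have "clopen (Z \<inter> shift_by n -` Z)"
    using Z by (intro clopen_Int clopen_vimage continuous_shift_by)
  from marker_set[OF this \<open>0 \<le> H\<close>, of "c / 2"] c obtain B where
    B: "clopen B" "B \<subseteq> Z \<inter> shift_by n -` Z" and
    sep: "\<forall>x\<in>B. \<forall>p\<in>{1..H}. shift_by p x \<notin> B" and
    "measure \<mu> (Z \<inter> shift_by n -` Z) \<le> (2 * H + 1) * measure \<mu> B + c / 2"
    by auto
  with rec have "c / 2 \<le> (2 * H + 1) * measure \<mu> B"
    by linarith
  also have "\<dots> \<le> (3 * H) * measure \<mu> B"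
    using H n by (intro mult_right_mono) auto
  finally have B_ge: "c / 2 \<le> 3 * (K * n) * measure \<mu> B"
    by (simp add: H_def)
  note tower = sep L(1) less_trans[OF lessI n(4)] H(1)
  have B_sets: "shift_by l -` B \<in> sets \<mu>" and B_meas: "measure \<mu> (shift_by l -` B) = measure \<mu> B" for l
    using clopen_in_sets[OF B(1)] by (simp_all add: shift_by_in_sets measure_shift_by)
  have B_union: "measure \<mu> (\<Union>l\<in>J. shift_by l -` B) = card J * measure \<mu> B"
    if "finite J" "\<And>k l. k \<in> J \<Longrightarrow> l \<in> J \<Longrightarrow> \<bar>k - l\<bar> \<le> H" for J
  proof -
    have "disjoint_family_on (\<lambda>l. shift_by l -` B) J"
      unfolding disjoint_family_on_def
    proof (intro ballI impI equals0I)
      fix k l x assume "k \<in> J" "l \<in> J" "k \<noteq> l" "x \<in> shift_by k -` B \<inter> shift_by l -` B"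
      then show False
        using separated_unique[OF tower, of k x l] that(2)[of k l] by simp
    qed
    then show ?thesis
      using that(1) B_sets B_meas by (subst finite_measure_finite_Union) auto
  qed
  define \<phi> where "\<phi> = tower_function B L n"
  have zero: "\<not> b i" if "b \<in> B" "0 \<le> i \<and> i < int L \<or> int n \<le> i \<and> i < int n + int L" for b i
  proof -
    have b: "b \<in> Z" "shift_by n b \<in> Z" using B(2) that(1) by auto
    from that(2) show ?thesis
    proof
      assume "0 \<le> i \<and> i < int L"
      then show ?thesis using b(1) by (simp add: Z_def)
    next
      assume "int n \<le> i \<and> i < int n + int L"
      then have "\<not> shift_by n b (i - int n)" using b(2) by (simp add: Z_def)
      then show ?thesis by (simp add: shift_by_def)
    qed
  qed
  \<comment> \<open>At a one, the time \<open>l\<close> since entry avoids both blocks of zeros, so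
    the ramp takes the same value, 0 or 1, at \<open>l\<close> and \<open>l + 1\<close>.\<close>
  have "twist \<phi>"
    unfolding twist_def
  proof (intro conjI allI impI)
    show "continuous_on UNIV \<phi>"
      unfolding \<phi>_def by (rule continuous_tower_function[OF B(1)])
    fix x :: "int \<Rightarrow> bool" assume x: "x 0"
    have "\<phi> x \<in> \<int> \<and> \<phi> (left_shift x) = \<phi> x"
    proof (cases rule: tower_function_left_shift[OF tower, of x])
      case (1 l)
      have "shift_by (- l) x l" using x by (simp add: shift_by_def)
      with zero[OF 1(1), of l] consider "l < 0" | "int L \<le> l" "l < int n" | "int n + int L \<le> l"
        by linarith
      then show ?thesis
        using 1(2,3) L(1) by cases (simp_all add: \<phi>_def ramp_eq_0 ramp_eq_1)
    qed (simp_all add: \<phi>_def)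
    then show "\<phi> x \<in> \<int>" "\<phi> (left_shift x) = \<phi> x" by auto
  qed
  moreover have "\<bar>\<phi> (left_shift x) - \<phi> x\<bar> \<le> \<eta>" for x
  proof (cases rule: tower_function_left_shift[OF tower, of x])
    case (1 l)
    then show ?thesis
      using ramp_Lipschitz[of L n l] L(2) by (simp add: \<phi>_def)
  qed (use \<open>0 < \<eta>\<close> in \<open>simp add: \<phi>_def\<close>)
  moreover have "measure \<mu> {x. \<phi> x \<noteq> 0} \<le> \<eta>"
  proof -
    have "H * measure \<mu> B \<le> card {1..H} * measure \<mu> B"
      using H by simp
    also have "\<dots> = measure \<mu> (\<Union>l\<in>{1..H}. shift_by l -` B)"
      by (rule B_union[symmetric]) auto
    also have "\<dots> \<le> 1" by (rule prob_le_1)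
    finally have B_le: "K * (n * measure \<mu> B) \<le> 1" by (simp add: H_def mult.assoc)
    have "measure \<mu> {x. \<phi> x \<noteq> 0} \<le> measure \<mu> (\<Union>l\<in>{- int n - int L..0}. shift_by l -` B)"
    proof (rule finite_measure_mono)
      show "{x. \<phi> x \<noteq> 0} \<subseteq> (\<Union>l\<in>{- int n - int L..0}. shift_by l -` B)"
      proof
        fix x assume "x \<in> {x. \<phi> x \<noteq> 0}"
        then obtain l where "l \<in> {0..int n + int L}" "shift_by (- l) x \<in> B"
          using tower_function_eq_0[of n L x B] by (auto simp: \<phi>_def)
        then show "x \<in> (\<Union>l\<in>{- int n - int L..0}. shift_by l -` B)"
          by (intro UN_I[of "- l"]) auto
      qed
    qed (use B_sets in auto)
    also have "\<dots> = card {- int n - int L..0} * measure \<mu> B"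
      using n H by (intro B_union) auto
    also have "\<dots> \<le> (2 * n) * measure \<mu> B"
      using n by (intro mult_right_mono) auto
    also have "\<dots> \<le> 2 / K"
      using B_le K by (simp add: field_simps)
    finally show ?thesis using K(2) by simp
  qed
  moreover have "2 * u n \<le> measure \<mu>
      {x. \<bar>birkhoff_sum left_shift (twisted (\<lambda>x. \<Phi> x + \<phi> x)) n x\<bar> \<le> n * a / 4}"
    (is "_ \<le> measure \<mu> ?bad")
  proof -
    \<comment> \<open>The points of \<open>Y\<close> enter the tower at a time close to \<open>n / 2\<close>.\<close>
    define J where "J = int ` {n div 2..<n div 2 + n div 32}"
    define Y where "Y = (\<Union>l\<in>J. shift_by l -` B)"
    have Y: "Y \<in> sets \<mu>"
      unfolding Y_def J_def using B_sets by (intro sets.finite_UN) auto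
    have "card J = n div 32"
      unfolding J_def by (subst card_image) auto
    moreover have "1 \<le> n div 32"
      using div_le_mono[OF n(5), of 32] by simp
    then have "n \<le> 64 * (n div 32)"
      using dividend_less_div_times[of 32 n] by linarith
    ultimately have "n \<le> 64 * card J" by (simp only:)
    then have card: "n / 64 \<le> card J"
      by simp
    have "2 * d \<le> n / 64 * measure \<mu> B"
      using B_ge K n by (simp add: d_def field_simps)
    also have "\<dots> \<le> card J * measure \<mu> B"
      using card by (intro mult_right_mono) auto
    also have "\<dots> = measure \<mu> Y"
      unfolding Y_def using H by (intro B_union[symmetric]) (auto simp: J_def)
    finally have "2 * d \<le> measure \<mu> Y" .
    moreover have "measure \<mu> Y + measure \<mu> G \<le> measure \<mu> (Y \<inter> G) + 1"
      using Y G(1) finite_measure_Union'[of Y G] finite_measure_Diff'[of G Y] prob_le_1[of "Y \<union> G"]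
      by (simp add: Int_commute)
    ultimately have "d \<le> measure \<mu> (Y \<inter> G)"
      using G(2) by linarith
    also have "\<dots> \<le> measure \<mu> ?bad"
    proof (rule finite_measure_mono)
      have "(\<lambda>x. \<Phi> x + \<phi> x) \<in> borel_measurable \<mu>"
        using twist_add[OF \<Phi> \<open>twist \<phi>\<close>] by (intro continuous_measurable) (simp add: twist_def)
      then have [measurable]: "birkhoff_sum left_shift (twisted (\<lambda>x. \<Phi> x + \<phi> x)) n \<in> borel_measurable \<mu>"
        by (intro birkhoff_sum_measurable twisted_measurable)
      have "{x \<in> space \<mu>. \<bar>birkhoff_sum left_shift (twisted (\<lambda>x. \<Phi> x + \<phi> x)) n x\<bar> \<le> n * a / 4} \<in> sets \<mu>"
        by measurable
      then show "?bad \<in> sets \<mu>" by simp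
      show "Y \<inter> G \<subseteq> ?bad"
      proof
        fix y assume y: "y \<in> Y \<inter> G"
        then obtain j where j: "n div 2 \<le> j" "j < n div 2 + n div 32" "shift_by j y \<in> B"
          by (auto simp: Y_def J_def)
        have "n \<le> 2 * (n div 2) + 1" "2 * (n div 2) \<le> n" "32 * (n div 32) \<le> n"
          using dividend_less_div_times[of 2 n] by simp_all
        then have "j \<le> n" and j': "n \<le> 2 * j + 1" "16 * (2 * j) \<le> 16 * n + n"
          using j(1,2) by linarith+
        \<comment> \<open>The orbit enters the tower at time \<open>j\<close> and is not yet on the
          final ramp at times before \<open>n\<close>. At ones \<open>\<phi>\<close> is therefore 0
          before \<open>j\<close> and 1 from \<open>j\<close> on, and adding 1 to
          \<open>\<Phi>\<close> flips the sign of the cosine.\<close>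
        have "twisted (\<lambda>x. \<Phi> x + \<phi> x) (shift_by i y) =
            (if i < j then 1 else - 1) * f (shift_by i y)" if i: "i < n" for i :: nat
        proof (cases "shift_by i y 0")
          case True
          define l where "l = int i - int j"
          have l: "shift_by (- l) (shift_by i y) \<in> B" "- int n \<le> l" "l < int n"
            using i j(3) \<open>j \<le> n\<close> by (auto simp: l_def)
          have "\<phi> (shift_by i y) = ramp L n l"
            unfolding \<phi>_def using l by (intro tower_function_eq_ramp[OF tower]) auto
          moreover have "l < 0 \<or> int L \<le> l"
            using zero[OF l(1), of l] True by (force simp: shift_by_def)
          ultimately have "\<phi> (shift_by i y) = (if i < j then 0 else 1)"
            using l L(1) by (auto simp: ramp_eq_0 ramp_eq_1 l_def)
          then show ?thesis
            using True by (simp add: f_def twisted_def distrib_left cos_add)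
        qed (simp add: f_def twisted_def)
        then have "birkhoff_sum left_shift (twisted (\<lambda>x. \<Phi> x + \<phi> x)) n y =
            (\<Sum>i<n. (if i < j then 1 else - 1) * f (shift_by i y))"
          by (simp add: birkhoff_sum_def funpow_left_shift)
        also have "\<dots> = (\<Sum>i<n. 2 * (if i < j then f (shift_by i y) else 0) - f (shift_by i y))"
          by (intro sum.cong) auto
        also have "\<dots> = 2 * (\<Sum>i<n. if i < j then f (shift_by i y) else 0) - (\<Sum>i<n. f (shift_by i y))"
          by (simp add: sum_subtractf sum_distrib_left)
        also have "(\<Sum>i<n. if i < j then f (shift_by i y) else 0) = (\<Sum>i<j. f (shift_by i y))"
          using \<open>j \<le> n\<close> by (intro sum.mono_neutral_cong_right) auto
        finally have eq: "birkhoff_sum left_shift (twisted (\<lambda>x. \<Phi> x + \<phi> x)) n y =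
            2 * birkhoff_sum left_shift f j y - birkhoff_sum left_shift f n y"
          by (simp add: birkhoff_sum_def funpow_left_shift)
        have "h \<le> j" "h \<le> n"
          using j'(1) n(3,5) by linarith+
        then have "\<bar>birkhoff_sum left_shift f j y - j * I\<bar> \<le> a / 24 * j"
          "\<bar>birkhoff_sum left_shift f n y - n * I\<bar> \<le> a / 24 * n"
          using y h[of y j] h[of y n] by simp_all
        moreover have "a / 24 * j \<le> a / 24 * n"
          using a \<open>j \<le> n\<close> by (intro mult_left_mono) auto
        moreover have "\<bar>2 * (j * I) - n * I\<bar> \<le> a * n / 8"
        proof -
          have "\<bar>2 * (j * I) - n * I\<bar> = \<bar>2 * real j - n\<bar> * \<bar>I\<bar>"
            by (simp add: abs_mult[symmetric] algebra_simps)
          also have "\<dots> \<le> (n / 8) * a"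
          proof (rule mult_mono)
            show "\<bar>2 * real j - n\<bar> \<le> n / 8"
              using n(5) j' by linarith
          qed (use I in auto)
          finally show ?thesis by (simp add: mult.commute)
        qed
        moreover have "a / 24 * n = (a * n) / 24"
          by simp
        ultimately have "\<bar>2 * birkhoff_sum left_shift f j y - birkhoff_sum left_shift f n y\<bar> \<le> (a * n) / 4"
          by linarith
        then have "\<bar>2 * birkhoff_sum left_shift f j y - birkhoff_sum left_shift f n y\<bar> \<le> n * a / 4"
          by (simp only: mult.commute)
        then show "y \<in> ?bad" by (simp add: eq)
      qed
    qed
    finally show ?thesis
      using n0[OF n(2)] by linarith
  qed
  ultimately show ?thesis
    using n(1) unfolding a_def by blast
qed

end

section \<open>Rotations and hyperbolic matrices\<close>

definition mat2 :: "real \<Rightarrow> real \<Rightarrow> real \<Rightarrow> real \<Rightarrow> real^2^2" where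
  "mat2 a b c d = (\<chi> i j. if i = 1 then (if j = 1 then a else b) else (if j = 1 then c else d))"

lemma mat2_nth [simp]:
  "mat2 a b c d $ 1 $ 1 = a" "mat2 a b c d $ 1 $ 2 = b"
  "mat2 a b c d $ 2 $ 1 = c" "mat2 a b c d $ 2 $ 2 = d"
  by (simp_all add: mat2_def)

lemma mat2_mult:
  "mat2 a b c d ** mat2 a' b' c' d' =
    mat2 (a * a' + b * c') (a * b' + b * d') (c * a' + d * c') (c * b' + d * d')"
  by (simp add: vec_eq_iff forall_2 matrix_matrix_mult_def sum_2)

lemma mat2_vector: "(mat2 a b c d *v v) $ 1 = a * v $ 1 + b * v $ 2"
  "(mat2 a b c d *v v) $ 2 = c * v $ 1 + d * v $ 2"
  by (simp_all add: matrix_vector_mult_def sum_2)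

lemma norm_vec_2: "(norm v)\<^sup>2 = (v $ 1)\<^sup>2 + (v $ 2)\<^sup>2" for v :: "real^2"
  by (simp add: norm_vec_def L2_set_def sum_2)

lemma continuous_on_mat2 [continuous_intros]:
  assumes "continuous_on S a" "continuous_on S b" "continuous_on S c" "continuous_on S d"
  shows "continuous_on S (\<lambda>x. mat2 (a x) (b x) (c x) (d x))"
  unfolding mat2_def
proof (intro continuous_on_vec_lambda)
  show "continuous_on S (\<lambda>x. if i = 1 then if j = 1 then a x else b x else if j = 1 then c x else d x)"
    for i j :: 2
    using assms by (cases "i = 1"; cases "j = 1") simp_all
qed

definition rot :: "real \<Rightarrow> real^2^2" where
  "rot t = mat2 (cos t) (- sin t) (sin t) (cos t)"

definition hyp :: "real \<Rightarrow> real^2^2" where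
  "hyp s = mat2 (exp s) 0 0 (exp (- s))"

lemma rot_mult: "rot s ** rot t = rot (s + t)"
  by (simp add: rot_def mat2_mult cos_add sin_add algebra_simps)

lemma hyp_mult: "hyp s ** hyp t = hyp (s + t)"
  by (simp add: hyp_def mat2_mult mult_exp_exp)

lemma rot_0: "rot 0 = mat 1" and hyp_0: "hyp 0 = mat 1"
  by (simp_all add: rot_def hyp_def vec_eq_iff forall_2 mat_def)

lemma det_rot: "det (rot t) = 1"
  by (simp add: rot_def det_2 flip: power2_eq_square)

lemma det_hyp: "det (hyp s) = 1"
  by (simp add: hyp_def det_2 flip: exp_add)

text \<open>For integer \<open>k\<close> the double angle has sine 0, so the cosine or the sine of
  \<open>pi / 2 * k\<close> vanishes: the rotation either preserves the coordinate axes or exchanges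
  them, and the exchange turns \<open>s\<close> into \<open>- s\<close>.\<close>

lemma rot_hyp_rot_quarter_turns:
  assumes "k \<in> \<int>"
  shows "rot (pi / 2 * k) ** hyp s ** rot (- (pi / 2 * k)) = hyp (s * cos (pi * k))"
proof -
  define c where "c = cos (pi / 2 * k)"
  define d where "d = sin (pi / 2 * k)"
  have cd: "c\<^sup>2 + d\<^sup>2 = 1"
    by (simp add: c_def d_def)
  have "cos (pi * k) = c\<^sup>2 - d\<^sup>2"
    using cos_double[of "pi / 2 * k"] by (simp add: c_def d_def)
  moreover have "2 * d * c = 0"
    using sin_double[of "pi / 2 * k"] assms
    by (auto simp: c_def d_def elim!: Ints_cases)
  ultimately have "c = 0 \<and> d\<^sup>2 = 1 \<and> cos (pi * k) = - 1 \<or> d = 0 \<and> c\<^sup>2 = 1 \<and> cos (pi * k) = 1"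
    using cd by auto
  moreover have sq: "c * (c * e) = c\<^sup>2 * e" "d * (d * e) = d\<^sup>2 * e" for e
    by (simp_all add: power2_eq_square)
  ultimately show ?thesis
    unfolding rot_def hyp_def mat2_mult cos_minus sin_minus c_def[symmetric] d_def[symmetric]
    by (elim disjE conjE) (simp_all add: algebra_simps sq)
qed

section \<open>Operator norms of rotations and hyperbolic matrices\<close>

lemma norm_rot: "norm (rot t *v v) = norm v"
proof -
  have "(norm (rot t *v v))\<^sup>2 = ((sin t)\<^sup>2 + (cos t)\<^sup>2) * (norm v)\<^sup>2"
    unfolding norm_vec_2 rot_def mat2_vector by (simp add: power2_eq_square algebra_simps del: sin_cos_squared_add sin_cos_squared_add2 sin_cos_squared_add3)
  then show ?thesis
    by simp
qed

lemma matrix_opnorm_le_iff: "matrix_opnorm A \<le> C \<longleftrightarrow> (\<forall>v. norm (A *v v) \<le> C * norm v)"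
proof
  show "\<forall>v. norm (A *v v) \<le> C * norm v" if "matrix_opnorm A \<le> C"
  proof
    fix v
    have "norm (A *v v) \<le> onorm ((*v) A) * norm v"
      by (intro onorm matrix_vector_mul_bounded_linear)
    also have "\<dots> \<le> C * norm v"
      using that by (intro mult_right_mono) (auto simp: matrix_opnorm_def)
    finally show "norm (A *v v) \<le> C * norm v" .
  qed
qed (auto simp: matrix_opnorm_def intro: onorm_le)

text \<open>Rotations are bijective isometries of the plane, so both matrices have the same upper
  bounds \<open>C\<close> for their norms.\<close>

lemma matrix_opnorm_rot_rot: "matrix_opnorm (rot s ** A ** rot t) = matrix_opnorm A"
proof -
  have "(\<forall>v. norm (A *v (rot t *v v)) \<le> C * norm (rot t *v v)) \<longleftrightarrow> (\<forall>v. norm (A *v v) \<le> C * norm v)" for C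
  proof -
    have "rot t *v (rot (- t) *v v) = v" for v
      by (simp add: matrix_vector_mul_assoc rot_mult rot_0)
    then show ?thesis by metis
  qed
  then have "matrix_opnorm (rot s ** A ** rot t) \<le> C \<longleftrightarrow> matrix_opnorm A \<le> C" for C
    unfolding matrix_opnorm_le_iff matrix_vector_mul_assoc[symmetric] norm_rot by simp
  then show ?thesis
    by (meson order.antisym order.refl)
qed

lemma matrix_opnorm_hyp: "matrix_opnorm (hyp s) = exp \<bar>s\<bar>"
proof (rule order.antisym)
  show "matrix_opnorm (hyp s) \<le> exp \<bar>s\<bar>"
    unfolding matrix_opnorm_le_iff
  proof
    fix v :: "real^2"
    have "(norm (hyp s *v v))\<^sup>2 = (exp s * v $ 1)\<^sup>2 + (exp (- s) * v $ 2)\<^sup>2"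
      unfolding norm_vec_2 hyp_def mat2_vector by simp
    also have "\<dots> \<le> (exp \<bar>s\<bar> * v $ 1)\<^sup>2 + (exp \<bar>s\<bar> * v $ 2)\<^sup>2"
      unfolding power_mult_distrib by (intro add_mono mult_right_mono power_mono) auto
    also have "\<dots> = (exp \<bar>s\<bar> * norm v)\<^sup>2"
      unfolding power_mult_distrib norm_vec_2 by (simp add: distrib_left)
    finally show "norm (hyp s *v v) \<le> exp \<bar>s\<bar> * norm v"
      by (rule power2_le_imp_le) simp
  qed
  have *: "norm (hyp s *v v) \<le> matrix_opnorm (hyp s) * norm v" for v
    using matrix_opnorm_le_iff by blast
  \<comment> \<open>The two basis vectors give the lower bound, one for each sign of
    \<open>s\<close>.\<close>
  have "\<bar>exp s\<bar> \<le> matrix_opnorm (hyp s)" "\<bar>exp (- s)\<bar> \<le> matrix_opnorm (hyp s)"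
    using order_trans[OF component_le_norm_cart[of "hyp s *v axis 1 1" 1] *]
      order_trans[OF component_le_norm_cart[of "hyp s *v axis 2 1" 2] *]
    by (simp_all add: hyp_def mat2_vector axis_nth norm_axis_1)
  then show "exp \<bar>s\<bar> \<le> matrix_opnorm (hyp s)"
    by (simp add: abs_if)
qed

section \<open>Iterates of continuous cocycles and of cocycles conjugate to diagonal ones\<close>

lemma continuous_on_matrix_mult:
  fixes f g :: "'a::topological_space \<Rightarrow> real^'n^'n"
  assumes "continuous_on S f" "continuous_on S g"
  shows "continuous_on S (\<lambda>x. f x ** g x)"
  unfolding matrix_matrix_mult_def using assms by (intro continuous_intros)

lemma continuous_cocycle_iter:
  assumes "continuous_on UNIV M" "continuous_on UNIV T"
  shows "continuous_on UNIV (cocycle_iter T M n)"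
proof -
  have T: "continuous_on UNIV (T ^^ n)" for n
    using assms(2) by (induction n) (auto intro: continuous_on_compose2 simp: o_def id_def)
  show ?thesis
  proof (induction n)
    case (Suc n)
    then have "continuous_on UNIV (\<lambda>x. M ((T ^^ n) x) ** cocycle_iter T M n x)"
      using assms(1) T by (intro continuous_on_matrix_mult continuous_on_compose2[OF assms(1) T]) auto
    then show ?case by simp
  qed simp
qed

text \<open>The rotations between consecutive factors cancel, and the hyperbolic factors multiply by
  adding their exponents.\<close>

lemma cocycle_iter_conjugate_hyp:
  assumes "\<And>i. M ((T ^^ i) x) = rot (\<theta> ((T ^^ Suc i) x)) ** hyp (f ((T ^^ i) x)) ** rot (- \<theta> ((T ^^ i) x))"
  shows "cocycle_iter T M n x = rot (\<theta> ((T ^^ n) x)) ** hyp (birkhoff_sum T f n x) ** rot (- \<theta> x)"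
proof (induction n)
  case 0
  then show ?case by (simp add: birkhoff_sum_def hyp_0 rot_mult rot_0)
next
  case (Suc n)
  let ?x = "(T ^^ n) x"
  have "cocycle_iter T M (Suc n) x =
      rot (\<theta> ((T ^^ Suc n) x)) ** hyp (f ?x) ** (rot (- \<theta> ?x) ** rot (\<theta> ?x)) **
      hyp (birkhoff_sum T f n x) ** rot (- \<theta> x)"
    using assms[of n] Suc by (simp add: matrix_mul_assoc)
  also have "\<dots> = rot (\<theta> ((T ^^ Suc n) x)) ** (hyp (f ?x) ** hyp (birkhoff_sum T f n x)) ** rot (- \<theta> x)"
    by (simp add: rot_mult rot_0 matrix_mul_assoc)
  finally show ?case
    by (simp add: hyp_mult birkhoff_sum_def add.commute)
qed

section \<open>The cocycle of an infinite sequence of twists\<close>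

context full_shift_system
begin

lemma measure_Union_geometric:
  fixes A :: "nat \<Rightarrow> (int \<Rightarrow> bool) set"
  assumes A: "\<And>j. A j \<in> sets \<mu>" "\<And>j. measure \<mu> (A j) \<le> \<eta> j"
    and \<eta>: "\<And>j. \<eta> (Suc j) \<le> \<eta> j / 2" "\<And>j. 0 < \<eta> j"
  shows "measure \<mu> (\<Union>j. A (k + j)) \<le> 2 * \<eta> k"
proof -
  have le: "\<eta> (k + j) \<le> \<eta> k * (1 / 2) ^ j" for j
  proof (induction j)
    case (Suc j)
    with \<eta>(1)[of "k + j"] show ?case by simp
  qed simp
  have sums: "(\<lambda>j. \<eta> k * (1 / 2) ^ j) sums (\<eta> k * 2)"
    using geometric_sums[of "1 / 2 :: real"] by (intro sums_mult) simp
  have bound: "measure \<mu> (A (k + j)) \<le> \<eta> k * (1 / 2) ^ j" for j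
    using A(2) le by (rule order_trans)
  have summable: "summable (\<lambda>j. measure \<mu> (A (k + j)))"
    using bound by (intro summable_comparison_test'[OF sums_summable[OF sums]]) auto
  have "measure \<mu> (\<Union>j. A (k + j)) \<le> (\<Sum>j. measure \<mu> (A (k + j)))"
    using A(1) summable by (intro finite_measure_subadditive_countably) auto
  also have "\<dots> \<le> (\<Sum>j. \<eta> k * (1 / 2) ^ j)"
    using bound summable sums_summable[OF sums] by (rule suminf_le)
  also have "\<dots> = 2 * \<eta> k"
    using sums by (simp add: sums_iff)
  finally show ?thesis .
qed

section \<open>Convergence of the sum of the twists, and the resulting cocycle\<close>

context
  fixes \<phi> :: "nat \<Rightarrow> (int \<Rightarrow> bool) \<Rightarrow> real" and \<eta> :: "nat \<Rightarrow> real"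
  assumes twist: "\<And>j. twist (\<phi> j)"
    and Lipschitz: "\<And>j x. \<bar>\<phi> j (left_shift x) - \<phi> j x\<bar> \<le> \<eta> j"
    and small: "\<And>j. measure \<mu> {x. \<phi> j x \<noteq> 0} \<le> \<eta> j"
    and pos: "\<And>j. 0 < \<eta> j" and half: "\<And>j. \<eta> (Suc j) \<le> \<eta> j / 2"
begin

text \<open>The series is a finite sum at almost every point. Where it diverges the value is
  meaningless, so only measurability and almost sure statements are available.\<close>

definition total_twist :: "(int \<Rightarrow> bool) \<Rightarrow> real" where
  "total_twist x = (\<Sum>j. \<phi> j x)"

text \<open>Summed term by term instead of subtracting two values of \<open>total_twist\<close>: by
  the bounds \<open>\<eta>\<close> this series converges uniformly everywhere, so the cocycle is
  continuous although \<open>total_twist\<close> need not be.\<close>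

definition twist_increment :: "(int \<Rightarrow> bool) \<Rightarrow> real" where
  "twist_increment x = (\<Sum>j. \<phi> j (left_shift x) - \<phi> j x)"

definition twist_cocycle :: "(int \<Rightarrow> bool) \<Rightarrow> real^2^2" where
  "twist_cocycle x = (if x 0 then hyp 1 else rot (pi / 2 * twist_increment x))"

definition later_twist :: "nat \<Rightarrow> (int \<Rightarrow> bool) set" where
  "later_twist k = {x. \<exists>j\<ge>k. \<phi> j x \<noteq> 0}"

lemma summable_\<eta>: "summable \<eta>"
proof (rule summable_comparison_test')
  show "summable (\<lambda>j. \<eta> 0 * (1 / 2) ^ j)"
    by (intro summable_mult summable_geometric) simp
  show "norm (\<eta> j) \<le> \<eta> 0 * (1 / 2) ^ j" if "0 \<le> j" for j
  proof (induction j)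
    case (Suc j)
    with half[of j] pos[of "Suc j"] pos[of j] show ?case by simp
  qed (use pos[of 0] in simp)
qed

lemma \<phi>_measurable [measurable]: "\<phi> j \<in> borel_measurable \<mu>"
  using twist by (intro continuous_measurable) (simp add: twist_def)

lemma total_twist_measurable [measurable]: "total_twist \<in> borel_measurable \<mu>"
  unfolding total_twist_def[abs_def] by measurable

lemma later_twist_eq: "later_twist k = (\<Union>j. {x. \<phi> (k + j) x \<noteq> 0})"
  by (auto simp: later_twist_def nat_le_iff_add)

lemma nonzero_in_sets: "{x. \<phi> j x \<noteq> 0} \<in> sets \<mu>"
proof -
  have "{x \<in> space \<mu>. \<phi> j x \<noteq> 0} \<in> sets \<mu>" by measurable
  then show ?thesis by simp
qed

lemma later_twist_in_sets: "later_twist k \<in> sets \<mu>"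
  unfolding later_twist_eq using nonzero_in_sets by auto

lemma measure_later_twist: "measure \<mu> (later_twist k) \<le> 2 * \<eta> k"
  unfolding later_twist_eq
  by (rule measure_Union_geometric[of "\<lambda>j. {x. \<phi> j x \<noteq> 0}" \<eta>, OF nonzero_in_sets small half pos])

lemma total_twist_eq_partial: "x \<notin> later_twist k \<Longrightarrow> total_twist x = (\<Sum>j<k. \<phi> j x)"
  unfolding total_twist_def later_twist_def by (intro suminf_finite) (auto simp: not_less)

text \<open>A Borel-Cantelli argument: the measure of \<open>later_twist k\<close> is at most
  \<open>2 * \<eta> k\<close>, which tends to 0, so almost every point avoids one of these sets;
  invariance extends this to all times of the orbit.\<close>

lemma AE_finitely_many_twists: "AE x in \<mu>. \<forall>i. \<exists>k. (left_shift ^^ i) x \<notin> later_twist k"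
proof -
  have "AE x in \<mu>. \<exists>k. (left_shift ^^ i) x \<notin> later_twist k" for i
  proof -
    define A where "A = (left_shift ^^ i) -` (\<Inter>k. later_twist k)"
    have sets: "(\<Inter>k. later_twist k) \<in> sets \<mu>"
      using later_twist_in_sets by auto
    have A: "A \<in> sets \<mu>"
      unfolding A_def using measurable_sets[OF funpow_measurable sets, of i] by simp
    have "measure \<mu> A \<le> 2 * \<eta> k" for k
    proof -
      have "measure \<mu> A = measure \<mu> (\<Inter>k. later_twist k)"
        unfolding A_def by (rule measure_vimage_funpow[OF sets])
      also have "\<dots> \<le> measure \<mu> (later_twist k)"
        using later_twist_in_sets by (intro finite_measure_mono) auto
      finally show ?thesis using measure_later_twist[of k] by linarith
    qed
    moreover have "(\<lambda>k. 2 * \<eta> k) \<longlonglongrightarrow> 2 * 0"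
      by (intro tendsto_intros summable_LIMSEQ_zero summable_\<eta>)
    ultimately have "measure \<mu> A \<le> 0"
      by (intro LIMSEQ_le_const[of "\<lambda>k. 2 * \<eta> k"]) auto
    then have "AE x in \<mu>. x \<notin> A"
      using A by (simp add: AE_iff_measurable[OF _ refl] emeasure_eq_measure measure_le_0_iff)
    then show ?thesis
      by eventually_elim (auto simp: A_def)
  qed
  then show ?thesis by (subst AE_all_countable) blast
qed

lemma continuous_twist_increment: "continuous_on UNIV twist_increment"
proof -
  have "uniform_limit UNIV (\<lambda>k x. \<Sum>j<k. \<phi> j (left_shift x) - \<phi> j x) twist_increment sequentially"
    unfolding twist_increment_def[abs_def]
    using Lipschitz summable_\<eta> by (intro Weierstrass_m_test) auto
  moreover have "continuous_on UNIV (\<lambda>x. \<Sum>j<k. \<phi> j (left_shift x) - \<phi> j x)" for k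
  proof (intro continuous_intros)
    show "continuous_on UNIV (\<phi> j)" for j
      using twist[of j] by (simp add: twist_def)
    then show "continuous_on UNIV (\<lambda>x. \<phi> j (left_shift x))" for j
      using continuous_shift_by[of 1]
      by (intro continuous_on_compose2[of UNIV "\<phi> j" UNIV left_shift])
         (simp_all add: left_shift_eq_shift_by)
  qed
  ultimately show ?thesis
    by (intro uniform_limit_theorem) auto
qed

lemma continuous_twist_cocycle: "continuous_on UNIV twist_cocycle"
proof -
  have "clopen {x :: int \<Rightarrow> bool. x 0}" "clopen {x :: int \<Rightarrow> bool. \<not> x 0}"
    by (rule clopen_coordinate clopen_not_coordinate)+
  moreover have "continuous_on {x. \<not> x 0} (\<lambda>x. rot (pi / 2 * twist_increment x))"
  proof (rule continuous_on_compose2[of UNIV rot])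
    show "continuous_on UNIV rot"
      unfolding rot_def[abs_def] by (intro continuous_intros)
    show "continuous_on {x. \<not> x 0} (\<lambda>x. pi / 2 * twist_increment x)"
      by (intro continuous_on_mult continuous_on_const
          continuous_on_subset[OF continuous_twist_increment subset_UNIV])
  qed simp
  ultimately have "continuous_on ({x. x 0} \<union> {x. \<not> x 0}) twist_cocycle"
    unfolding twist_cocycle_def[abs_def] clopen_def by (intro continuous_on_cases) auto
  moreover have "{x. x 0} \<union> {x. \<not> x 0} = (UNIV :: (int \<Rightarrow> bool) set)"
    by auto
  ultimately show ?thesis by simp
qed

lemma twist_cocycle_SL2: "continuous_SL2_cocycle twist_cocycle"
  using continuous_twist_cocycle
  by (auto simp: continuous_SL2_cocycle_def twist_cocycle_def det_rot det_hyp)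

text \<open>At a one every \<open>\<phi> j\<close> is unchanged by the shift and the total is an
  integer, being a finite sum, so conjugation can only change the sign of the exponent. At a zero
  both totals are finite sums, so the increment is their difference, and the hyperbolic factor is
  trivial.\<close>

lemma twist_cocycle_eq:
  assumes "x \<notin> later_twist k" "left_shift x \<notin> later_twist l"
  shows "twist_cocycle x = rot (pi / 2 * total_twist (left_shift x)) ** hyp (twisted total_twist x) **
           rot (- (pi / 2 * total_twist x))"
proof (cases "x 0")
  case True
  have shift: "total_twist (left_shift x) = total_twist x"
    using twist True by (simp add: total_twist_def twist_def)
  have int: "total_twist x \<in> \<int>"
    unfolding total_twist_eq_partial[OF assms(1)] using twist True
    by (intro Ints_sum) (simp add: twist_def)
  \<comment> \<open>The sign occurs twice, in \<open>twisted\<close> and through the conjugation,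
    and cancels.\<close>
  then have "(cos (pi * total_twist x))\<^sup>2 = 1"
    by (simp add: cos_squared_eq sin_times_pi_eq_0 mult.commute[of pi])
  then show ?thesis
    unfolding shift rot_hyp_rot_quarter_turns[OF int]
    using True by (simp add: twist_cocycle_def twisted_def power2_eq_square)
next
  case False
  have "summable (\<lambda>j. \<phi> j y)" if "y \<notin> later_twist k" for y k
    using that by (intro summable_finite[of "{..<k}"]) (auto simp: later_twist_def not_less)
  then have "twist_increment x = total_twist (left_shift x) - total_twist x"
    unfolding twist_increment_def total_twist_def using assms by (intro suminf_diff[symmetric])
  then show ?thesis
    using False by (simp add: twist_cocycle_def twisted_def hyp_0 rot_mult right_diff_distrib)
qed

text \<open>Almost surely the iterates are diagonal in the rotating frame, and the rotations at both
  ends do not affect the norm.\<close>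

lemma AE_ln_opnorm_twist_cocycle:
  "AE x in \<mu>. \<forall>n. ln (matrix_opnorm (cocycle_iter left_shift twist_cocycle n x)) =
     \<bar>birkhoff_sum left_shift (twisted total_twist) n x\<bar>"
  using AE_finitely_many_twists
proof eventually_elim
  case (elim x)
  show ?case
  proof
    fix n
    have "twist_cocycle ((left_shift ^^ i) x) =
        rot (pi / 2 * total_twist ((left_shift ^^ Suc i) x)) ** hyp (twisted total_twist ((left_shift ^^ i) x)) **
        rot (- (pi / 2 * total_twist ((left_shift ^^ i) x)))" for i
    proof -
      obtain k l where "(left_shift ^^ i) x \<notin> later_twist k" "(left_shift ^^ Suc i) x \<notin> later_twist l"
        using elim by blast
      then show ?thesis
        using twist_cocycle_eq[of "(left_shift ^^ i) x" k l] by simp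
    qed
    from cocycle_iter_conjugate_hyp[of twist_cocycle left_shift x "\<lambda>x. pi / 2 * total_twist x", OF this, of n]
    show "ln (matrix_opnorm (cocycle_iter left_shift twist_cocycle n x)) =
        \<bar>birkhoff_sum left_shift (twisted total_twist) n x\<bar>"
      by (simp add: matrix_opnorm_rot_rot matrix_opnorm_hyp)
  qed
qed

lemma twist_cocycle_Lyapunov_exponent:
  "has_top_lyapunov_exponent \<mu> left_shift twist_cocycle \<bar>\<integral>x. twisted total_twist x \<partial>\<mu>\<bar>"
  unfolding has_top_lyapunov_exponent_def
  using AE_ln_opnorm_twist_cocycle
    birkhoff_ergodic_theorem[OF twisted_integrable[OF total_twist_measurable]]
proof eventually_elim
  case (elim x)
  from tendsto_rabs[OF elim(2)] show ?case
    using elim(1) by simp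
qed

text \<open>Off \<open>later_twist 0\<close> the total twist is 0 and the integrand equals the
  indicator of the ones; on that set it loses at most 2.\<close>

lemma integral_twisted_total_twist_ge:
  "measure \<mu> {x. x 0} - 4 * \<eta> 0 \<le> (\<integral>x. twisted total_twist x \<partial>\<mu>)"
proof -
  have sets: "{x. x 0} \<in> sets \<mu>"
    by (intro clopen_in_sets clopen_coordinate)
  have "measure \<mu> {x. x 0} - 4 * \<eta> 0 \<le> measure \<mu> {x. x 0} - 2 * measure \<mu> (later_twist 0)"
    using measure_later_twist[of 0] by simp
  also have "\<dots> = (\<integral>x. indicator {x. x 0} x - 2 * indicator (later_twist 0) x \<partial>\<mu>)"
    using sets later_twist_in_sets[of 0] by (simp add: less_top[symmetric])
  also have "\<dots> \<le> (\<integral>x. twisted total_twist x \<partial>\<mu>)"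
  proof (rule integral_mono)
    show "indicator {x. x 0} x - 2 * indicator (later_twist 0) x \<le> twisted total_twist x" for x
    proof (cases "x \<in> later_twist 0")
      case True
      then show ?thesis
        using abs_twisted_le[of total_twist x] cos_ge_minus_one[of "pi * total_twist x"]
        by (cases "x 0") (simp_all add: twisted_def)
    next
      case False
      then show ?thesis
        using total_twist_eq_partial[OF False] by (cases "x 0") (simp_all add: twisted_def)
    qed
  qed (use sets later_twist_in_sets[of 0] twisted_integrable[OF total_twist_measurable] in
      \<open>auto simp: less_top[symmetric]\<close>)
  finally show ?thesis .
qed

text \<open>The sublevel sets of the norm are intersections of closed conditions over all vectors
  \<open>v\<close>. Closedness survives such an uncountable intersection, where measurability alone
  need not.\<close>

lemma ln_opnorm_iter_measurable:
  "(\<lambda>x. ln (matrix_opnorm (cocycle_iter left_shift twist_cocycle n x))) \<in> borel_measurable \<mu>"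
proof -
  have cont: "continuous_on UNIV (cocycle_iter left_shift twist_cocycle n)"
    using continuous_twist_cocycle continuous_shift_by[of 1]
    by (intro continuous_cocycle_iter) (simp_all add: left_shift_eq_shift_by)
  have "closed {x. matrix_opnorm (cocycle_iter left_shift twist_cocycle n x) \<le> C}" for C
    unfolding matrix_opnorm_le_iff matrix_vector_mult_def
    by (intro closed_Collect_all closed_Collect_le continuous_intros cont)
  then have "{x. matrix_opnorm (cocycle_iter left_shift twist_cocycle n x) \<le> C} \<in> sets \<mu>" for C
    by (simp add: sets_eq)
  then have "(\<lambda>x. matrix_opnorm (cocycle_iter left_shift twist_cocycle n x)) \<in> borel_measurable \<mu>"
    by (simp add: borel_measurable_iff_le)
  then show ?thesis by measurable
qed

text \<open>Truncating the twist after \<open>k\<close> terms alters the sum of length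
  \<open>n\<close> only at points whose orbit meets \<open>later_twist k\<close> before time
  \<open>n\<close>; by invariance their measure is at most
  \<open>n * (2 * \<eta> k)\<close>.\<close>

lemma measure_deviation_ge:
  assumes "b \<le> c"
  shows "measure \<mu> {x. \<bar>birkhoff_sum left_shift (twisted (\<lambda>x. \<Sum>j<k. \<phi> j x)) n x\<bar> \<le> b} - n * (2 * \<eta> k)
    \<le> measure \<mu> {x \<in> space \<mu>. ln (matrix_opnorm (cocycle_iter left_shift twist_cocycle n x)) \<le> c}"
  (is "measure \<mu> ?P - _ \<le> measure \<mu> ?L")
proof -
  define Q where "Q = {x. \<bar>birkhoff_sum left_shift (twisted total_twist) n x\<bar> \<le> c}"
  define E where "E = (\<Union>i<n. (left_shift ^^ i) -` later_twist k)"
  have E_sets: "(left_shift ^^ i) -` later_twist k \<in> sets \<mu>" for i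
    using measurable_sets[OF funpow_measurable later_twist_in_sets, of i k] by simp
  have "{x \<in> space \<mu>. \<bar>birkhoff_sum left_shift (twisted total_twist) n x\<bar> \<le> c} \<in> sets \<mu>"
    using birkhoff_sum_measurable[OF twisted_measurable[OF total_twist_measurable], of n]
    by measurable
  then have Q: "Q \<in> sets \<mu>" by (simp add: Q_def)
  have "?P \<subseteq> Q \<union> E"
  proof (rule subsetI)
    fix x assume x: "x \<in> ?P"
    show "x \<in> Q \<union> E"
    proof (cases "x \<in> E")
      case False
      then have "birkhoff_sum left_shift (twisted total_twist) n x =
          birkhoff_sum left_shift (twisted (\<lambda>x. \<Sum>j<k. \<phi> j x)) n x"
        unfolding birkhoff_sum_def E_def twisted_def
        by (intro sum.cong refl) (simp add: total_twist_eq_partial[of _ k])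
      with x assms show ?thesis by (simp add: Q_def)
    qed simp
  qed
  then have "measure \<mu> ?P \<le> measure \<mu> (Q \<union> E)"
    using Q E_sets by (intro finite_measure_mono) (auto simp: E_def)
  also have "\<dots> \<le> measure \<mu> Q + measure \<mu> E"
    using Q E_sets by (intro measure_Un_le) (auto simp: E_def)
  also have "measure \<mu> E \<le> (\<Sum>i<n. measure \<mu> ((left_shift ^^ i) -` later_twist k))"
    unfolding E_def using E_sets by (intro finite_measure_subadditive_finite) auto
  also have "\<dots> = n * measure \<mu> (later_twist k)"
    by (simp add: measure_vimage_funpow[OF later_twist_in_sets])
  also have "\<dots> \<le> n * (2 * \<eta> k)"
    using measure_later_twist by (intro mult_left_mono) auto
  also have "measure \<mu> Q = measure \<mu> ?L"
  proof (rule finite_measure_eq_AE)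
    show "AE x in \<mu>. x \<in> Q \<longleftrightarrow> x \<in> ?L"
      using AE_ln_opnorm_twist_cocycle by eventually_elim (simp add: Q_def)
    show "?L \<in> sets \<mu>"
      using ln_opnorm_iter_measurable[of n] by measurable
  qed (rule Q)
  finally show ?thesis by simp
qed

end

text \<open>Dependent choice with \<open>twist_with_deviation\<close> as the successor step. The
  bound for the next twist is fixed after the time of the current deviation, so that all later
  twists together destroy at most \<open>u (N j)\<close> of it.\<close>

lemma twist_sequence:
  assumes u: "\<And>n. 0 < u n" "u \<longlonglongrightarrow> (0::real)"
  defines "a \<equiv> measure \<mu> {x. x 0}"
  shows "\<exists>(\<phi> :: nat \<Rightarrow> (int \<Rightarrow> bool) \<Rightarrow> real) \<eta> N. \<eta> 0 = a / 8 \<and> strict_mono N \<and>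
    (\<forall>j. twist (\<phi> j) \<and> (\<forall>x. \<bar>\<phi> j (left_shift x) - \<phi> j x\<bar> \<le> \<eta> j) \<and>
      measure \<mu> {x. \<phi> j x \<noteq> 0} \<le> \<eta> j \<and> 0 < \<eta> j \<and> \<eta> (Suc j) \<le> \<eta> j / 2 \<and>
      2 * u (N j) \<le> measure \<mu>
        {x. \<bar>birkhoff_sum left_shift (twisted (\<lambda>x. \<Sum>i<Suc j. \<phi> i x)) (N j) x\<bar> \<le> N j * a / 4} \<and>
      N j * (2 * \<eta> (Suc j)) \<le> u (N j))"
proof -
  have "(\<lambda>_. True) \<in> {x :: int \<Rightarrow> bool. x 0}" by simp
  then have a: "0 < a"
    unfolding a_def using measure_clopen_pos[OF clopen_coordinate[of 0]] by blast
  \<comment> \<open>A state holds the sum of the twists so far, the bound for the next twist and the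
    last deviation time; the initial time 0 is a dummy.\<close>
  define P where "P k s \<longleftrightarrow> (case s of (\<Phi>, e, n) \<Rightarrow>
      twist \<Phi> \<and> 0 < e \<and> (k = 0 \<longrightarrow> \<Phi> = (\<lambda>_. 0) \<and> e = a / 8))"
    for k :: nat and s :: "((int \<Rightarrow> bool) \<Rightarrow> real) \<times> real \<times> nat"
  define Q where "Q s s' \<longleftrightarrow> (case (s, s') of ((\<Phi>, e, n), (\<Phi>', e', n')) \<Rightarrow>
      twist (\<lambda>x. \<Phi>' x - \<Phi> x) \<and> n < n' \<and>
      (\<forall>x. \<bar>(\<Phi>' (left_shift x) - \<Phi> (left_shift x)) - (\<Phi>' x - \<Phi> x)\<bar> \<le> e) \<and>
      measure \<mu> {x. \<Phi>' x - \<Phi> x \<noteq> 0} \<le> e \<and> e' \<le> e / 2 \<and>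
      2 * u n' \<le> measure \<mu> {x. \<bar>birkhoff_sum left_shift (twisted \<Phi>') n' x\<bar> \<le> n' * a / 4} \<and>
      n' * (2 * e') \<le> u n')"
    for s s' :: "((int \<Rightarrow> bool) \<Rightarrow> real) \<times> real \<times> nat"
  have "\<exists>s. \<forall>k. P k (s k) \<and> Q (s k) (s (Suc k))"
  proof (rule dependent_nat_choice)
    show "\<exists>s. P 0 s"
      using a by (intro exI[of _ "(\<lambda>_. 0, a / 8, 0)"]) (simp add: P_def twist_def)
    fix s k assume "P k s"
    moreover obtain \<Phi> e n where s: "s = (\<Phi>, e, n)" by (cases s)
    ultimately have \<Phi>: "twist \<Phi>" and e: "0 < e" by (auto simp: P_def)
    from twist_with_deviation[OF \<Phi> e u(2), of n, folded a_def] obtain \<phi> n' where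
      \<phi>: "twist \<phi>" "n < n'" "\<forall>x. \<bar>\<phi> (left_shift x) - \<phi> x\<bar> \<le> e" "measure \<mu> {x. \<phi> x \<noteq> 0} \<le> e"
        "2 * u n' \<le> measure \<mu>
          {x. \<bar>birkhoff_sum left_shift (twisted (\<lambda>x. \<Phi> x + \<phi> x)) n' x\<bar> \<le> n' * a / 4}"
      by blast
    \<comment> \<open>Halving makes the bounds summable; the second term of the minimum makes
      \<open>n' * (2 * e')\<close> at most \<open>u n'\<close>.\<close>
    define e' where "e' = min (e / 2) (u n' / (2 * n'))"
    have e': "0 < e'" "e' \<le> e / 2"
      using e u(1)[of n'] \<phi>(2) by (auto simp: e'_def)
    have "e' \<le> u n' / (2 * n')"
      by (simp add: e'_def)
    then have "n' * (2 * e') \<le> u n'"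
      using \<phi>(2) by (simp add: field_simps)
    then show "\<exists>s'. P (Suc k) s' \<and> Q s s'"
      using \<phi> e' twist_add[OF \<Phi> \<phi>(1)]
      by (intro exI[of _ "(\<lambda>x. \<Phi> x + \<phi> x, e', n')"]) (simp add: P_def Q_def s)
  qed
  then obtain s where s: "\<And>k. P k (s k)" "\<And>k. Q (s k) (s (Suc k))" by blast
  define \<Phi> where "\<Phi> k = fst (s k)" for k
  define \<eta> where "\<eta> k = fst (snd (s k))" for k
  \<comment> \<open>A state carries the time of the step that produced it, so the deviation time
    belonging to twist \<open>k\<close> is found in state \<open>Suc k\<close>.\<close>
  define N where "N k = snd (snd (s (Suc k)))" for k
  define \<phi> where "\<phi> k x = \<Phi> (Suc k) x - \<Phi> k x" for k x
  have 0: "\<Phi> 0 = (\<lambda>_. 0)" "\<eta> 0 = a / 8"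
    using s(1)[of 0] by (auto simp: P_def \<Phi>_def \<eta>_def split: prod.splits)
  have \<Phi>_eq: "\<Phi> k = (\<lambda>x. \<Sum>j<k. \<phi> j x)" for k
    using sum_lessThan_telescope[of "\<lambda>k. \<Phi> k x" k for x] by (simp add: \<phi>_def 0)
  have "strict_mono N"
    unfolding strict_mono_Suc_iff
  proof
    show "N k < N (Suc k)" for k
      using s(2)[of "Suc k"] unfolding Q_def N_def case_prod_unfold fst_conv snd_conv by blast
  qed
  moreover have "twist (\<phi> j) \<and> (\<forall>x. \<bar>\<phi> j (left_shift x) - \<phi> j x\<bar> \<le> \<eta> j) \<and>
      measure \<mu> {x. \<phi> j x \<noteq> 0} \<le> \<eta> j \<and> 0 < \<eta> j \<and> \<eta> (Suc j) \<le> \<eta> j / 2 \<and>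
      2 * u (N j) \<le> measure \<mu> {x. \<bar>birkhoff_sum left_shift (twisted (\<Phi> (Suc j))) (N j) x\<bar> \<le> N j * a / 4} \<and>
      N j * (2 * \<eta> (Suc j)) \<le> u (N j)" for j
    using s(1)[of j] s(2)[of j]
    unfolding P_def Q_def \<phi>_def[abs_def] \<Phi>_def \<eta>_def N_def case_prod_unfold fst_conv snd_conv by blast
  ultimately show ?thesis
    using 0(2) unfolding \<Phi>_eq by blast
qed

end

theorem theoremA3:
  fixes u :: "nat \<Rightarrow> real" and \<mu> :: "(int \<Rightarrow> bool) measure"
  assumes "\<And>n. 0 < u n" and "u \<longlonglongrightarrow> 0"
    and "ergodic_prob \<mu> left_shift" and "fully_supported \<mu>"
  shows "\<exists>(M :: (int \<Rightarrow> bool) \<Rightarrow> real^2^2) l.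
           continuous_SL2_cocycle M \<and>
           has_top_lyapunov_exponent \<mu> left_shift M l \<and> 0 < l \<and>
           infinite {n. u n \<le> measure \<mu>
             {x \<in> space \<mu>. ln (matrix_opnorm (cocycle_iter left_shift M n x)) \<le> real n * l / 2}}"
proof -
  interpret full_shift_system \<mu>
    using assms by unfold_locales
  define a where "a = measure \<mu> {x. x 0}"
  obtain \<phi> :: "nat \<Rightarrow> (int \<Rightarrow> bool) \<Rightarrow> real" and \<eta> N where \<eta>0: "\<eta> 0 = a / 8" and N: "strict_mono N" and
    twist: "\<And>j. twist (\<phi> j)" "\<And>j x. \<bar>\<phi> j (left_shift x) - \<phi> j x\<bar> \<le> \<eta> j"
      "\<And>j. measure \<mu> {x. \<phi> j x \<noteq> 0} \<le> \<eta> j" "\<And>j. 0 < \<eta> j" "\<And>j. \<eta> (Suc j) \<le> \<eta> j / 2" and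
    deviation: "\<And>j. 2 * u (N j) \<le> measure \<mu>
        {x. \<bar>birkhoff_sum left_shift (twisted (\<lambda>x. \<Sum>i<Suc j. \<phi> i x)) (N j) x\<bar> \<le> N j * a / 4}" and
    N\<eta>: "\<And>j. N j * (2 * \<eta> (Suc j)) \<le> u (N j)"
    using twist_sequence[OF assms(1,2), folded a_def] by blast
  define M where "M = twist_cocycle \<phi>"
  define l where "l = \<bar>\<integral>x. twisted (total_twist \<phi>) x \<partial>\<mu>\<bar>"
  have "0 < a"
    using twist(4)[of 0] \<eta>0 by simp
  \<comment> \<open>The choice \<open>\<eta> 0 = a / 8\<close> gives
    \<open>a - 4 * \<eta> 0 = a / 2\<close>, so the threshold \<open>N j * a / 4\<close> of the
    deviation is at most \<open>N j * l / 2\<close>.\<close>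
  have l: "a / 2 \<le> l"
    using integral_twisted_total_twist_ge[of \<phi> \<eta>, OF twist] \<eta>0 by (simp add: l_def a_def)
  have "u (N j) \<le> measure \<mu>
      {x \<in> space \<mu>. ln (matrix_opnorm (cocycle_iter left_shift M (N j) x)) \<le> N j * l / 2}" for j
  proof -
    have "N j * a / 4 \<le> N j * l / 2"
      using mult_left_mono[OF l, of "real (N j)"] by (simp add: mult.commute)
    \<comment> \<open>Of the measure \<open>2 * u (N j)\<close> the later twists remove at most
      \<open>u (N j)\<close>.\<close>
    from measure_deviation_ge[of \<phi> \<eta>, OF twist this, of "Suc j" "N j"] deviation[of j] N\<eta>[of j]
    show ?thesis unfolding M_def by linarith
  qed
  then have "range N \<subseteq> {n. u n \<le> measure \<mu>
      {x \<in> space \<mu>. ln (matrix_opnorm (cocycle_iter left_shift M n x)) \<le> real n * l / 2}}"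
    by auto
  moreover have "infinite (range N)"
    using N by (intro range_inj_infinite strict_mono_imp_inj_on)
  ultimately have "infinite {n. u n \<le> measure \<mu>
      {x \<in> space \<mu>. ln (matrix_opnorm (cocycle_iter left_shift M n x)) \<le> real n * l / 2}}"
    by (rule infinite_super)
  moreover have "continuous_SL2_cocycle M"
    unfolding M_def by (rule twist_cocycle_SL2[of \<phi> \<eta>, OF twist])
  moreover have "has_top_lyapunov_exponent \<mu> left_shift M l"
    unfolding M_def l_def by (rule twist_cocycle_Lyapunov_exponent[of \<phi> \<eta>, OF twist])
  moreover have "0 < l"
    using l \<open>0 < a\<close> by linarith
  ultimately show ?thesis by blast
qed

end
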